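(* Let $\chi^{1k\ell},\chi^{2k\ell m}$ be the first and second elastostatic cell functions, $\zeta^{2n}$ the second inertial cell functions, $\beta=\rho/\langle\rho\rangle$ the relative mass density, and $B^1$, $B^2$, $\beta^2$ the inertial effective tensors of order 3, 4, 2 (all defined in the context). Then, for all indices in $\{1,\dots,d\}$: (i) the first-order inertial tensor is given in terms of $\chi^1$ by $$B^1_{ik\ell}=\frac1{|\mathcal Y|}\int_{\mathcal Y}\beta\big(\chi^{1k\ell}_i-\chi^{1i\ell}_k\big)\,dy=\langle\beta\chi^{1k\ell}_i\rangle-\langle\beta\chi^{1i\ell}_k\rangle ;$$ (ii) the second-order inertial tensor $B^2$ is given in terms of $\chi^1$ and $\chi^2$ by $$B^2_{i\ell km}=\frac1{|\mathcal Y|}\int_{\mathcal Y}\beta\Big[\chi^{2mk\ell}_i+\chi^{2i\ell m}_k-\chi^{1i\ell}_r\chi^{1km}_r\Big]\,dy ;$$ (iii) the tensor $\beta^2$ is given in terms of $\zeta^2$ by $$|\mathcal Y|\,\beta^2_{ik}=A(\zeta^{2i},\zeta^{2k}),$$ and is therefore positive definite unless the mass density is homogeneous ($\beta=1$ a.e.), in which case $\beta^2=0$.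
   Context: Let $d\in\{2,3\}$; repeated indices are summed and $f_{,s}=\partial f/\partial y_s$. Cell and material. $v_1,\dots,v_d$ is a basis of $\mathbb R^d$ and $\mathcal Z=\{\sum_i n_iv_i:\ n_i\in\mathbb Z\}$. The periodicity cell $\mathcal Y\subset\mathbb R^d$ is a bounded open set (with Lebesgue-null boundary) whose translates $\mathcal Y+V$, $V\in\mathcal Z$, are pairwise disjoint and have closures covering $\mathbb R^d$. The elasticity tensor $C=(C_{ijk\ell})\in L^\infty(\mathcal Y)$ is real, has the symmetries $C_{ijk\ell}=C_{jik\ell}=C_{ij\ell k}=C_{k\ell ij}$ and satisfies $\varepsilon_{ij}C_{ijk\ell}(y)\varepsilon_{k\ell}\ge\kappa_m|\varepsilon|^2$ for all symmetric $\varepsilon$ and some $\kappa_m>0$. The mass density $\rho\in L^\infty(\mathcal Y)$ satisfies $\rho\ge\rho_m>0$. Function spaces. $H^1_{per}(\mathcal Y;\mathbb R^d)$ is the closure in $H^1(\mathcal Y)$ of smooth $\mathcal Z$-periodic vector functions on $\mathbb R^d$; $H^1_\#(\mathcal Y)$ is its subspace of zero-mean functions. $\langle f\rangle:=|\mathcal Y|^{-1}\int_{\mathcal Y}f\,dy$. $A(w,v):=\int_{\mathcal Y}w_{i,j}C_{ijk\ell}v_{k,\ell}\,dy$. Densities: $\rho^0:=\langle\rho\rangle$, $\beta(y):=\rho(y)/\rho^0$. Elastostatic cell functions (each cell function here and below is the unique element of $H^1_\#(\mathcal Y)$ satisfying the stated identity for all $v\in H^1_\#(\mathcal Y)$; superscripts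 are loading indices, subscripts are components): - $A(\chi^{1k\ell},v)=-\int_{\mathcal Y}C_{k\ell rs}v_{r,s}\,dy$; $\ S^{0,k\ell}_{ij}:=C_{ijpq}\chi^{1k\ell}_{p,q}+C_{ijk\ell}$; $\ C^0_{ijk\ell}:=\langle S^{0,k\ell}_{ij}\rangle$. - $A(\chi^{2k\ell m},v)=\int_{\mathcal Y}\{(S^{0,k\ell}_{mr}-C^0_{k\ell mr})v_r-\chi^{1k\ell}_pC_{pmrs}v_{r,s}\}\,dy$. Inertial cell functions and inertial effective tensors: - $A(\zeta^{2n},v)=\int_{\mathcal Y}(\beta-1)v_n\,dy$. - $\phi^1_{ik\ell}:=C_{i\ell pq}\zeta^{2k}_{p,q}+\beta\chi^{1k\ell}_i$; $\ B^1_{ik\ell}:=\langle\phi^1_{ik\ell}\rangle$. - $A(\zeta^{3k\ell},v)=\int_{\mathcal Y}(\phi^1_{rk\ell}-B^1_{rk\ell})v_r\,dy-\int_{\mathcal Y}\zeta^{2k}_aC_{a\ell rs}v_{r,s}\,dy$. - $\phi^2_{i\ell km}:=C_{i\ell ab}\zeta^{3km}_{a,b}+C_{i\ell am}\zeta^{2k}_a+\beta\chi^{2mk\ell}_i$; $\ B^2_{i\ell km}:=\langle\phi^2_{i\ell km}\rangle$. - $\beta^2_{ik}:=\langle\beta\,\zeta^{2k}_i\rangle$ (the superscript 2 in $\beta^2$ is a label, not a power). *)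

theory Defs
  imports "HOL-Analysis.Analysis"
begin

type_synonym 'd scalar_field = "real ^ 'd \<Rightarrow> real"
type_synonym 'd vector_field = "real ^ 'd \<Rightarrow> real ^ 'd"
type_synonym 'd tensor4_field = "real ^ 'd \<Rightarrow> 'd \<Rightarrow> 'd \<Rightarrow> 'd \<Rightarrow> 'd \<Rightarrow> real"

definition partial_deriv :: "'d::finite \<Rightarrow> 'd scalar_field \<Rightarrow> 'd scalar_field" where
  "partial_deriv j f x = frechet_derivative f (at x) (axis j 1)"

fun Ck :: "nat \<Rightarrow> 'd::finite scalar_field \<Rightarrow> bool" where
  "Ck 0 f \<longleftrightarrow> continuous_on UNIV f"
| "Ck (Suc k) f \<longleftrightarrow> (\<forall>x. f differentiable (at x)) \<and> (\<forall>j. Ck k (partial_deriv j f))"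

definition smooth :: "'d::finite scalar_field \<Rightarrow> bool" where
  "smooth f \<longleftrightarrow> (\<forall>k. Ck k f)"

definition test_function :: "(real ^ 'd::finite) set \<Rightarrow> 'd scalar_field \<Rightarrow> bool" where
  "test_function Y \<psi> \<longleftrightarrow>
     smooth \<psi> \<and> (\<exists>K. compact K \<and> K \<subseteq> Y \<and> (\<forall>x. x \<notin> K \<longrightarrow> \<psi> x = 0))"

definition lattice :: "('d::finite \<Rightarrow> real ^ 'd) \<Rightarrow> (real ^ 'd) set" where
  "lattice b = {\<Sum>i\<in>UNIV. of_int (n i) *\<^sub>R b i | n :: 'd \<Rightarrow> int. True}"

definition lattice_basis :: "('d::finite \<Rightarrow> real ^ 'd) \<Rightarrow> bool" where
  "lattice_basis b \<longleftrightarrow> inj b \<and> independent (range b) \<and> span (range b) = UNIV"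

definition periodicity_cell :: "(real ^ 'd::finite) set \<Rightarrow> (real ^ 'd) set \<Rightarrow> bool" where
  "periodicity_cell Z Y \<longleftrightarrow>
     open Y \<and> bounded Y \<and> negligible (frontier Y) \<and>
     (\<forall>V\<in>Z. \<forall>W\<in>Z. V \<noteq> W \<longrightarrow> ((+) V ` Y) \<inter> ((+) W ` Y) = {}) \<and>
     (\<Union>V\<in>Z. closure ((+) V ` Y)) = UNIV"

definition smooth_periodic :: "(real ^ 'd::finite) set \<Rightarrow> 'd vector_field \<Rightarrow> bool" where
  "smooth_periodic Z \<phi> \<longleftrightarrow>
     (\<forall>i. smooth (\<lambda>x. \<phi> x $ i)) \<and> (\<forall>V\<in>Z. \<forall>x. \<phi> (x + V) = \<phi> x)"

text \<open>
  Elements of the spaces below are representatives, not classes modulo null sets; their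
  values outside the cell are irrelevant.
\<close>

definition cell_avg :: "(real ^ 'd::finite) set \<Rightarrow> 'd scalar_field \<Rightarrow> real" where
  "cell_avg Y f = 1 / measure lebesgue Y * (\<integral>y. f y \<partial>lebesgue_on Y)"

definition Linf :: "(real ^ 'd::finite) set \<Rightarrow> 'd scalar_field \<Rightarrow> bool" where
  "Linf Y f \<longleftrightarrow>
     f \<in> borel_measurable (lebesgue_on Y) \<and> (\<exists>K. AE y in lebesgue_on Y. \<bar>f y\<bar> \<le> K)"

definition L2 :: "(real ^ 'd::finite) set \<Rightarrow> 'd scalar_field \<Rightarrow> bool" where
  "L2 Y f \<longleftrightarrow>
     f \<in> borel_measurable (lebesgue_on Y) \<and> integrable (lebesgue_on Y) (\<lambda>y. (f y)\<^sup>2)"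

definition is_weak_partial ::
    "(real ^ 'd::finite) set \<Rightarrow> 'd \<Rightarrow> 'd scalar_field \<Rightarrow> 'd scalar_field \<Rightarrow> bool" where
  "is_weak_partial Y j f g \<longleftrightarrow>
     (\<forall>\<psi>. test_function Y \<psi> \<longrightarrow>
        (\<integral>y. f y * partial_deriv j \<psi> y \<partial>lebesgue_on Y) =
        - (\<integral>y. g y * \<psi> y \<partial>lebesgue_on Y))"

definition H1 :: "(real ^ 'd::finite) set \<Rightarrow> 'd vector_field set" where
  "H1 Y = {w. \<forall>i. L2 Y (\<lambda>y. w y $ i) \<and>
                  (\<forall>j. \<exists>g. L2 Y g \<and> is_weak_partial Y j (\<lambda>y. w y $ i) g)}"

text \<open>
  For \<open>w \<in> H1 Y\<close>, \<open>wgrad Y w i j\<close> is the weak derivative \<open>w\<^sub>i\<^sub>,\<^sub>j\<close>. It is unique up to a null set,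
  so the integrals below do not depend on the chosen representative.
\<close>

definition wgrad :: "(real ^ 'd::finite) set \<Rightarrow> 'd vector_field \<Rightarrow> 'd \<Rightarrow> 'd \<Rightarrow> 'd scalar_field" where
  "wgrad Y w i j = (SOME g. L2 Y g \<and> is_weak_partial Y j (\<lambda>y. w y $ i) g)"

definition H1_norm :: "(real ^ 'd::finite) set \<Rightarrow> 'd vector_field \<Rightarrow> real" where
  "H1_norm Y w = sqrt (\<Sum>i\<in>UNIV. (\<integral>y. (w y $ i)\<^sup>2 \<partial>lebesgue_on Y) +
                          (\<Sum>j\<in>UNIV. \<integral>y. (wgrad Y w i j y)\<^sup>2 \<partial>lebesgue_on Y))"

definition H1_per :: "(real ^ 'd::finite) set \<Rightarrow> (real ^ 'd) set \<Rightarrow> 'd vector_field set" where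
  "H1_per Z Y =
     {w \<in> H1 Y. \<forall>e>0. \<exists>\<phi>. smooth_periodic Z \<phi> \<and> H1_norm Y (\<lambda>y. w y - \<phi> y) < e}"

definition H1_mean0 :: "(real ^ 'd::finite) set \<Rightarrow> (real ^ 'd) set \<Rightarrow> 'd vector_field set" where
  "H1_mean0 Z Y = {w \<in> H1_per Z Y. \<forall>i. cell_avg Y (\<lambda>y. w y $ i) = 0}"

definition elasticity_tensor :: "(real ^ 'd::finite) set \<Rightarrow> 'd tensor4_field \<Rightarrow> bool" where
  "elasticity_tensor Y C \<longleftrightarrow>
     (\<forall>i j k l. Linf Y (\<lambda>y. C y i j k l)) \<and>
     (AE y in lebesgue_on Y. \<forall>i j k l.
        C y i j k l = C y j i k l \<and> C y i j k l = C y i j l k \<and> C y i j k l = C y k l i j) \<and>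
     (\<exists>\<kappa>>0. AE y in lebesgue_on Y. \<forall>\<epsilon> :: 'd \<Rightarrow> 'd \<Rightarrow> real. (\<forall>i j. \<epsilon> i j = \<epsilon> j i) \<longrightarrow>
        (\<Sum>i\<in>UNIV. \<Sum>j\<in>UNIV. \<Sum>k\<in>UNIV. \<Sum>l\<in>UNIV. \<epsilon> i j * C y i j k l * \<epsilon> k l)
          \<ge> \<kappa> * (\<Sum>i\<in>UNIV. \<Sum>j\<in>UNIV. (\<epsilon> i j)\<^sup>2))"

definition mass_density :: "(real ^ 'd::finite) set \<Rightarrow> 'd scalar_field \<Rightarrow> bool" where
  "mass_density Y \<rho> \<longleftrightarrow> Linf Y \<rho> \<and> (\<exists>\<rho>m>0. AE y in lebesgue_on Y. \<rho> y \<ge> \<rho>m)"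

definition rel_density :: "(real ^ 'd::finite) set \<Rightarrow> 'd scalar_field \<Rightarrow> 'd scalar_field" where
  "rel_density Y \<rho> y = \<rho> y / cell_avg Y \<rho>"

definition energy_form ::
    "(real ^ 'd::finite) set \<Rightarrow> 'd tensor4_field \<Rightarrow> 'd vector_field \<Rightarrow> 'd vector_field \<Rightarrow> real" where
  "energy_form Y C w v =
     (\<integral>y. (\<Sum>i\<in>UNIV. \<Sum>j\<in>UNIV. \<Sum>k\<in>UNIV. \<Sum>l\<in>UNIV.
             wgrad Y w i j y * C y i j k l * wgrad Y v k l y) \<partial>lebesgue_on Y)"

text \<open>
  \<open>F\<close> is the right-hand side of the variational identity. By Korn's inequality and the
  Lax--Milgram theorem the solution exists and is unique up to a null set.
\<close>

definition cell_function ::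
    "(real ^ 'd::finite) set \<Rightarrow> (real ^ 'd) set \<Rightarrow> 'd tensor4_field \<Rightarrow>
     ('d vector_field \<Rightarrow> real) \<Rightarrow> 'd vector_field \<Rightarrow> bool" where
  "cell_function Z Y C F w \<longleftrightarrow>
     w \<in> H1_mean0 Z Y \<and> (\<forall>v\<in>H1_mean0 Z Y. energy_form Y C w v = F v)"

text \<open>
  Index convention: loading indices come first, then the field components. Thus \<open>\<chi>1 k l y $ i\<close>
  is \<open>\<chi>\<^sub>i\<close> with loading indices \<open>k, l\<close>, and \<open>S0 Y C \<chi>1 k l y i j\<close> is \<open>S\<^sub>i\<^sub>j\<close> with loading
  indices \<open>k, l\<close>. The tensors \<open>C0\<close>, \<open>\<phi>\<close> and \<open>B\<close> take their subscripts in the order in which they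
  are written.
\<close>

definition chi1_load :: "(real ^ 'd::finite) set \<Rightarrow> 'd tensor4_field \<Rightarrow>
    'd \<Rightarrow> 'd \<Rightarrow> 'd vector_field \<Rightarrow> real" where
  "chi1_load Y C k l v =
     - (\<integral>y. (\<Sum>r\<in>UNIV. \<Sum>s\<in>UNIV. C y k l r s * wgrad Y v r s y) \<partial>lebesgue_on Y)"

definition S0 :: "(real ^ 'd::finite) set \<Rightarrow> 'd tensor4_field \<Rightarrow>
    ('d \<Rightarrow> 'd \<Rightarrow> 'd vector_field) \<Rightarrow> 'd \<Rightarrow> 'd \<Rightarrow> real ^ 'd \<Rightarrow> 'd \<Rightarrow> 'd \<Rightarrow> real" where
  "S0 Y C \<chi>1 k l y i j =
     (\<Sum>p\<in>UNIV. \<Sum>q\<in>UNIV. C y i j p q * wgrad Y (\<chi>1 k l) p q y) + C y i j k l"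

definition C0 :: "(real ^ 'd::finite) set \<Rightarrow> 'd tensor4_field \<Rightarrow>
    ('d \<Rightarrow> 'd \<Rightarrow> 'd vector_field) \<Rightarrow> 'd \<Rightarrow> 'd \<Rightarrow> 'd \<Rightarrow> 'd \<Rightarrow> real" where
  "C0 Y C \<chi>1 i j k l = cell_avg Y (\<lambda>y. S0 Y C \<chi>1 k l y i j)"

definition chi2_load :: "(real ^ 'd::finite) set \<Rightarrow> 'd tensor4_field \<Rightarrow>
    ('d \<Rightarrow> 'd \<Rightarrow> 'd vector_field) \<Rightarrow> 'd \<Rightarrow> 'd \<Rightarrow> 'd \<Rightarrow> 'd vector_field \<Rightarrow> real" where
  "chi2_load Y C \<chi>1 k l m v =
     (\<integral>y. (\<Sum>r\<in>UNIV. (S0 Y C \<chi>1 k l y m r - C0 Y C \<chi>1 k l m r) * v y $ r) -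
           (\<Sum>p\<in>UNIV. \<Sum>r\<in>UNIV. \<Sum>s\<in>UNIV. \<chi>1 k l y $ p * C y p m r s * wgrad Y v r s y)
        \<partial>lebesgue_on Y)"

definition zeta2_load :: "(real ^ 'd::finite) set \<Rightarrow> 'd scalar_field \<Rightarrow>
    'd \<Rightarrow> 'd vector_field \<Rightarrow> real" where
  "zeta2_load Y \<beta> n v = (\<integral>y. (\<beta> y - 1) * v y $ n \<partial>lebesgue_on Y)"

definition phi1 :: "(real ^ 'd::finite) set \<Rightarrow> 'd tensor4_field \<Rightarrow> 'd scalar_field \<Rightarrow>
    ('d \<Rightarrow> 'd \<Rightarrow> 'd vector_field) \<Rightarrow> ('d \<Rightarrow> 'd vector_field) \<Rightarrow>
    'd \<Rightarrow> 'd \<Rightarrow> 'd \<Rightarrow> 'd scalar_field" where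
  "phi1 Y C \<beta> \<chi>1 \<zeta>2 i k l y =
     (\<Sum>p\<in>UNIV. \<Sum>q\<in>UNIV. C y i l p q * wgrad Y (\<zeta>2 k) p q y) + \<beta> y * \<chi>1 k l y $ i"

definition B1 :: "(real ^ 'd::finite) set \<Rightarrow> 'd tensor4_field \<Rightarrow> 'd scalar_field \<Rightarrow>
    ('d \<Rightarrow> 'd \<Rightarrow> 'd vector_field) \<Rightarrow> ('d \<Rightarrow> 'd vector_field) \<Rightarrow> 'd \<Rightarrow> 'd \<Rightarrow> 'd \<Rightarrow> real" where
  "B1 Y C \<beta> \<chi>1 \<zeta>2 i k l = cell_avg Y (phi1 Y C \<beta> \<chi>1 \<zeta>2 i k l)"

definition zeta3_load :: "(real ^ 'd::finite) set \<Rightarrow> 'd tensor4_field \<Rightarrow> 'd scalar_field \<Rightarrow>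
    ('d \<Rightarrow> 'd \<Rightarrow> 'd vector_field) \<Rightarrow> ('d \<Rightarrow> 'd vector_field) \<Rightarrow>
    'd \<Rightarrow> 'd \<Rightarrow> 'd vector_field \<Rightarrow> real" where
  "zeta3_load Y C \<beta> \<chi>1 \<zeta>2 k l v =
     (\<integral>y. (\<Sum>r\<in>UNIV. (phi1 Y C \<beta> \<chi>1 \<zeta>2 r k l y - B1 Y C \<beta> \<chi>1 \<zeta>2 r k l) * v y $ r)
        \<partial>lebesgue_on Y) -
     (\<integral>y. (\<Sum>a\<in>UNIV. \<Sum>r\<in>UNIV. \<Sum>s\<in>UNIV. \<zeta>2 k y $ a * C y a l r s * wgrad Y v r s y)
        \<partial>lebesgue_on Y)"

definition phi2 :: "(real ^ 'd::finite) set \<Rightarrow> 'd tensor4_field \<Rightarrow> 'd scalar_field \<Rightarrow>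
    ('d \<Rightarrow> 'd \<Rightarrow> 'd \<Rightarrow> 'd vector_field) \<Rightarrow> ('d \<Rightarrow> 'd vector_field) \<Rightarrow>
    ('d \<Rightarrow> 'd \<Rightarrow> 'd vector_field) \<Rightarrow> 'd \<Rightarrow> 'd \<Rightarrow> 'd \<Rightarrow> 'd \<Rightarrow> 'd scalar_field" where
  "phi2 Y C \<beta> \<chi>2 \<zeta>2 \<zeta>3 i l k m y =
     (\<Sum>a\<in>UNIV. \<Sum>b\<in>UNIV. C y i l a b * wgrad Y (\<zeta>3 k m) a b y) +
     (\<Sum>a\<in>UNIV. C y i l a m * \<zeta>2 k y $ a) + \<beta> y * \<chi>2 m k l y $ i"

definition B2 :: "(real ^ 'd::finite) set \<Rightarrow> 'd tensor4_field \<Rightarrow> 'd scalar_field \<Rightarrow>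
    ('d \<Rightarrow> 'd \<Rightarrow> 'd \<Rightarrow> 'd vector_field) \<Rightarrow> ('d \<Rightarrow> 'd vector_field) \<Rightarrow>
    ('d \<Rightarrow> 'd \<Rightarrow> 'd vector_field) \<Rightarrow> 'd \<Rightarrow> 'd \<Rightarrow> 'd \<Rightarrow> 'd \<Rightarrow> real" where
  "B2 Y C \<beta> \<chi>2 \<zeta>2 \<zeta>3 i l k m = cell_avg Y (phi2 Y C \<beta> \<chi>2 \<zeta>2 \<zeta>3 i l k m)"

definition beta2 :: "(real ^ 'd::finite) set \<Rightarrow> 'd scalar_field \<Rightarrow>
    ('d \<Rightarrow> 'd vector_field) \<Rightarrow> real ^ 'd ^ 'd" where
  "beta2 Y \<beta> \<zeta>2 = (\<chi> i k. cell_avg Y (\<lambda>y. \<beta> y * \<zeta>2 k y $ i))"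

definition positive_definite :: "real ^ 'd ^ 'd::finite \<Rightarrow> bool" where
  "positive_definite M \<longleftrightarrow> transpose M = M \<and> (\<forall>x. x \<noteq> 0 \<longrightarrow> x \<bullet> (M *v x) > 0)"

end

theory Submission
  imports Defs
begin

text \<open>
  The energy form \<open>A\<close> is symmetric. Testing the equation of one cell function with another one and
  conversely therefore gives two expressions for the same number (\<open>load_reciprocity\<close>). In \<open>B1\<close> and \<open>B2\<close>
  the stress of the highest inertial cell function has this form: the integral of \<open>C\<^sub>i\<^sub>l\<^sub>p\<^sub>qw\<^sub>p\<^sub>,\<^sub>q\<close> is minus
  the load of \<open>\<chi>\<^bsup>1il\<^esup>\<close> on \<open>w\<close>. One swap expresses \<open>B1\<close> by \<open>\<chi>1\<close> (\<open>B1_formula\<close>). In \<open>B2\<close> a first swap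
  eliminates \<open>\<zeta>3\<close>, and the terms with \<open>\<zeta>2\<close> that remain are together the load of \<open>\<chi>\<^bsup>2ilm\<^esup>\<close> on \<open>\<zeta>\<^bsup>2k\<^esup>\<close>, which a
  second swap turns into an integral of \<open>\<beta>\<chi>2\<close> (\<open>B2_formula\<close>). Testing the equation of \<open>\<zeta>\<^bsup>2i\<^esup>\<close> with \<open>\<zeta>\<^bsup>2k\<^esup>\<close>
  gives \<open>|Y| \<beta>2\<^sub>i\<^sub>k = A(\<zeta>\<^bsup>2i\<^esup>, \<zeta>\<^bsup>2k\<^esup>)\<close>.

  So \<open>\<beta>2\<close> is a Gram matrix and positive semidefinite. If it degenerates in a direction \<open>x\<close>, the field
  \<open>\<Sum>x\<^sub>n\<zeta>\<^bsup>2n\<^esup>\<close> has zero strain, hence zero energy against every field (\<open>energy_form_degenerate\<close>); by its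
  equation \<open>(\<beta> - 1)x\<close> is orthogonal to all periodic fields of zero mean, and this forces \<open>\<beta> = 1\<close>
  (\<open>density_constant_if_orthogonal\<close>).

  The last step is where analysis enters. One needs enough periodic fields: test functions of
  the cell are extended periodically (\<open>test_function_periodic_extension\<close>), and smooth periodic fields lie
  in the Sobolev space because integration by parts holds for them (\<open>smooth_weak_partial\<close>). One also needs
  the fundamental lemma of the calculus of variations (\<open>AE_eq_0_if_orthogonal_to_test_functions\<close>), whose
  proof rests on smooth cutoffs that approximate indicators of boxes.
\<close>

section \<open>Square-integrable functions on a set of finite measure\<close>

lemma L2_Linf_mult:
  assumes "Linf Y c" "L2 Y f"
  shows "L2 Y (\<lambda>y. c y * f y)"
proof -
  obtain K where K: "AE y in lebesgue_on Y. \<bar>c y\<bar> \<le> K"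
    using assms(1) by (auto simp: Linf_def)
  have [measurable]: "c \<in> borel_measurable (lebesgue_on Y)" "f \<in> borel_measurable (lebesgue_on Y)"
    using assms by (auto simp: Linf_def L2_def)
  have "integrable (lebesgue_on Y) (\<lambda>y. (c y * f y)\<^sup>2)"
  proof (rule Bochner_Integration.integrable_bound)
    show "integrable (lebesgue_on Y) (\<lambda>y. K\<^sup>2 * (f y)\<^sup>2)"
      using assms(2) by (simp add: L2_def)
    show "AE y in lebesgue_on Y. norm ((c y * f y)\<^sup>2) \<le> norm (K\<^sup>2 * (f y)\<^sup>2)"
      using K
    proof eventually_elim
      case (elim y)
      then have "(c y)\<^sup>2 \<le> K\<^sup>2" by (metis abs_ge_zero power2_abs power_mono)
      then show ?case by (simp add: power_mult_distrib mult_right_mono)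
    qed
  qed simp
  then show ?thesis by (simp add: L2_def)
qed

lemma integrable_L2_mult:
  assumes "L2 Y f" "L2 Y g"
  shows "integrable (lebesgue_on Y) (\<lambda>y. f y * g y)"
proof (rule Bochner_Integration.integrable_bound)
  show "integrable (lebesgue_on Y) (\<lambda>y. (f y)\<^sup>2 + (g y)\<^sup>2)"
    using assms by (simp add: L2_def)
  show "(\<lambda>y. f y * g y) \<in> borel_measurable (lebesgue_on Y)"
    using assms by (auto simp: L2_def)
  have "\<bar>a * b\<bar> \<le> a\<^sup>2 + b\<^sup>2" for a b :: real
    using sum_squares_bound[of "\<bar>a\<bar>" "\<bar>b\<bar>"] abs_ge_zero[of "a * b"]
    unfolding abs_mult power2_abs by linarith
  then show "AE y in lebesgue_on Y. norm (f y * g y) \<le> norm ((f y)\<^sup>2 + (g y)\<^sup>2)"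
    by simp
qed

lemma L2_add:
  assumes "L2 Y f" "L2 Y g"
  shows "L2 Y (\<lambda>y. f y + g y)"
  using assms integrable_L2_mult[OF assms]
  by (auto simp: L2_def power2_sum mult.assoc)

lemma L2_zero: "L2 Y (\<lambda>_. 0)"
  by (simp add: L2_def)

lemma L2_sum: "(\<And>i. i \<in> I \<Longrightarrow> L2 Y (f i)) \<Longrightarrow> L2 Y (\<lambda>y. \<Sum>i\<in>I. f i y)"
  by (induction I rule: infinite_finite_induct) (auto intro: L2_zero L2_add)

lemma L2_const:
  assumes "Y \<in> lmeasurable"
  shows "L2 Y (\<lambda>_. a)"
proof -
  interpret finite_measure "lebesgue_on Y"
    using assms by (rule finite_measure_lebesgue_on)
  show ?thesis by (simp add: L2_def)
qed

lemma L2_Linf: "Y \<in> lmeasurable \<Longrightarrow> Linf Y c \<Longrightarrow> L2 Y c"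
  using L2_Linf_mult[of Y c "\<lambda>_. 1"] L2_const[of Y 1] by simp

lemma integrable_L2: "Y \<in> lmeasurable \<Longrightarrow> L2 Y f \<Longrightarrow> integrable (lebesgue_on Y) f"
  using integrable_L2_mult[of Y f "\<lambda>_. 1"] L2_const[of Y 1] by simp

section \<open>The elastic energy form\<close>

lemma L2_component: "w \<in> H1 Y \<Longrightarrow> L2 Y (\<lambda>y. w y $ i)"
  by (simp add: H1_def)

lemma wgrad_weak_partial:
  assumes "w \<in> H1 Y"
  shows "L2 Y (wgrad Y w i j) \<and> is_weak_partial Y j (\<lambda>y. w y $ i) (wgrad Y w i j)"
proof -
  have "\<exists>g. L2 Y g \<and> is_weak_partial Y j (\<lambda>y. w y $ i) g"
    using assms by (simp add: H1_def)
  then show ?thesis unfolding wgrad_def by (rule someI_ex)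
qed

lemma L2_wgrad: "w \<in> H1 Y \<Longrightarrow> L2 Y (wgrad Y w i j)"
  by (simp add: wgrad_weak_partial)

lemma H1_mean0_imp_H1: "w \<in> H1_mean0 Z Y \<Longrightarrow> w \<in> H1 Y"
  by (simp add: H1_mean0_def H1_per_def)

definition tensor_form ::
    "('d::finite \<Rightarrow> 'd \<Rightarrow> 'd \<Rightarrow> 'd \<Rightarrow> real) \<Rightarrow> ('d \<Rightarrow> 'd \<Rightarrow> real) \<Rightarrow> ('d \<Rightarrow> 'd \<Rightarrow> real) \<Rightarrow> real" where
  "tensor_form c G H = (\<Sum>i\<in>UNIV. \<Sum>j\<in>UNIV. \<Sum>k\<in>UNIV. \<Sum>l\<in>UNIV. G i j * c i j k l * H k l)"

abbreviation grad :: "(real ^ 'd::finite) set \<Rightarrow> 'd vector_field \<Rightarrow> real ^ 'd \<Rightarrow> 'd \<Rightarrow> 'd \<Rightarrow> real" where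
  "grad Y w y \<equiv> \<lambda>i j. wgrad Y w i j y"

lemma energy_form_eq:
  "energy_form Y C w v = (\<integral>y. tensor_form (C y) (grad Y w y) (grad Y v y) \<partial>lebesgue_on Y)"
  by (simp add: energy_form_def tensor_form_def)

definition hooke_symmetric :: "('d::finite \<Rightarrow> 'd \<Rightarrow> 'd \<Rightarrow> 'd \<Rightarrow> real) \<Rightarrow> bool" where
  "hooke_symmetric c \<longleftrightarrow>
     (\<forall>i j k l. c i j k l = c j i k l \<and> c i j k l = c i j l k \<and> c i j k l = c k l i j)"

lemma elasticity_tensor_Linf: "elasticity_tensor Y C \<Longrightarrow> Linf Y (\<lambda>y. C y i j k l)"
  by (simp add: elasticity_tensor_def)

lemma elasticity_tensor_symmetric:
  "elasticity_tensor Y C \<Longrightarrow> AE y in lebesgue_on Y. hooke_symmetric (C y)"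
  by (simp add: elasticity_tensor_def hooke_symmetric_def)

lemma tensor_form_commute:
  assumes "hooke_symmetric c"
  shows "tensor_form c G H = tensor_form c H G"
proof -
  have "tensor_form c G H
      = (\<Sum>p\<in>UNIV. \<Sum>q\<in>UNIV. G (fst p) (snd p) * c (fst p) (snd p) (fst q) (snd q) * H (fst q) (snd q))"
    by (simp add: tensor_form_def sum.cartesian_product' UNIV_Times_UNIV[symmetric] del: UNIV_Times_UNIV)
  also have "\<dots> = (\<Sum>q\<in>UNIV. \<Sum>p\<in>UNIV. H (fst q) (snd q) * c (fst q) (snd q) (fst p) (snd p) * G (fst p) (snd p))"
    by (subst sum.swap) (use assms in \<open>simp add: hooke_symmetric_def mult_ac\<close>)
  also have "\<dots> = tensor_form c H G"
    by (simp add: tensor_form_def sum.cartesian_product' UNIV_Times_UNIV[symmetric] del: UNIV_Times_UNIV)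
  finally show ?thesis .
qed

lemma tensor_form_sum_left:
  "tensor_form c (\<lambda>i j. \<Sum>n\<in>I. a n * G n i j) H = (\<Sum>n\<in>I. a n * tensor_form c (G n) H)"
proof -
  have "(\<Sum>n\<in>I. a n * tensor_form c (G n) H)
      = (\<Sum>i\<in>UNIV. \<Sum>j\<in>UNIV. \<Sum>k\<in>UNIV. \<Sum>l\<in>UNIV. \<Sum>n\<in>I. a n * (G n i j * c i j k l * H k l))"
    unfolding tensor_form_def sum_distrib_left by (simp only: sum.swap[of _ UNIV I])
  then show ?thesis
    by (simp add: tensor_form_def sum_distrib_right mult.assoc)
qed

text \<open>
  The minor symmetries make the energy depend on the strain only: the skew part of a gradient
  does not contribute.
\<close>

lemma tensor_form_symmetrize:
  assumes "hooke_symmetric c"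
  shows "tensor_form c G H = tensor_form c (\<lambda>i j. (G i j + G j i) / 2) H"
proof -
  have "tensor_form c (\<lambda>i j. G j i) H = tensor_form c G H"
    unfolding tensor_form_def
    by (subst sum.swap) (use assms in \<open>simp add: hooke_symmetric_def\<close>)
  moreover have "tensor_form c (\<lambda>i j. (G i j + G j i) / 2) H
      = (tensor_form c G H + tensor_form c (\<lambda>i j. G j i) H) / 2"
    by (simp add: tensor_form_def sum.distrib sum_divide_distrib add_divide_distrib distrib_right)
  ultimately show ?thesis by simp
qed

text \<open>
  Coercivity bounds the energy below by the strain, so a gradient without energy is skew, and then
  its stress vanishes. Hence it does no work against any other gradient.
\<close>

lemma tensor_form_coercive:
  assumes c: "hooke_symmetric c" and "\<kappa> > 0"
    and "\<forall>\<epsilon> :: 'd::finite \<Rightarrow> 'd \<Rightarrow> real. (\<forall>i j. \<epsilon> i j = \<epsilon> j i) \<longrightarrow>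
           tensor_form c \<epsilon> \<epsilon> \<ge> \<kappa> * (\<Sum>i\<in>UNIV. \<Sum>j\<in>UNIV. (\<epsilon> i j)\<^sup>2)"
  shows "tensor_form c G G \<ge> 0"
    and "tensor_form c G G = 0 \<Longrightarrow> tensor_form c G H = 0"
proof -
  define S where "S = (\<lambda>i j. (G i j + G j i) / 2)"
  let ?n = "\<Sum>i\<in>UNIV. \<Sum>j\<in>UNIV. (S i j)\<^sup>2"
  have n: "?n \<ge> 0" by (intro sum_nonneg) auto
  have "tensor_form c G G = tensor_form c S S"
    using tensor_form_symmetrize[OF c, of G G] tensor_form_commute[OF c, of S G]
      tensor_form_symmetrize[OF c, of G S] by (simp add: S_def)
  moreover have "\<forall>i j. S i j = S j i" by (simp add: S_def add.commute)
  ultimately have coercive: "tensor_form c G G \<ge> \<kappa> * ?n"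
    using assms(3)[rule_format, of S] by simp
  then show "tensor_form c G G \<ge> 0"
    using n \<open>\<kappa> > 0\<close> mult_nonneg_nonneg[of \<kappa> ?n] by linarith
  assume "tensor_form c G G = 0"
  with coercive have "?n = 0"
    using n \<open>\<kappa> > 0\<close> mult_pos_pos[of \<kappa> ?n] by linarith
  then have "S i j = 0" for i j
    by (simp add: sum_nonneg_eq_0_iff sum_nonneg)
  then have "tensor_form c S H = 0" by (simp add: tensor_form_def)
  then show "tensor_form c G H = 0"
    using tensor_form_symmetrize[OF c] unfolding S_def by metis
qed

lemma integrable_energy_density:
  assumes "elasticity_tensor Y C" "w \<in> H1 Y" "v \<in> H1 Y"
  shows "integrable (lebesgue_on Y) (\<lambda>y. tensor_form (C y) (grad Y w y) (grad Y v y))"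
proof -
  have "integrable (lebesgue_on Y) (\<lambda>y. (C y i j k l * wgrad Y w i j y) * wgrad Y v k l y)" for i j k l
    by (intro integrable_L2_mult L2_Linf_mult L2_wgrad elasticity_tensor_Linf assms)
  then show ?thesis
    unfolding tensor_form_def by (intro Bochner_Integration.integrable_sum) (simp add: mult_ac)
qed

lemma energy_form_commute:
  assumes "elasticity_tensor Y C" "w \<in> H1 Y" "v \<in> H1 Y"
  shows "energy_form Y C w v = energy_form Y C v w"
  unfolding energy_form_eq
proof (rule integral_cong_AE)
  show "AE y in lebesgue_on Y. tensor_form (C y) (grad Y w y) (grad Y v y)
      = tensor_form (C y) (grad Y v y) (grad Y w y)"
    using elasticity_tensor_symmetric[OF assms(1)]
    by eventually_elim (rule tensor_form_commute)
qed (use assms in \<open>blast intro: borel_measurable_integrable integrable_energy_density\<close>)+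

text \<open>
  The kernel of the energy form: \<open>\<Sum>a\<^sub>nw\<^sub>n\<close> has no energy only if its strain is zero almost everywhere,
  which leaves it no stress to work against \<open>v\<close>. The combination is formed from the weak gradients that \<open>wgrad\<close> selects and not from the fields, because on these representatives
  the energy density is bilinear at every point.
\<close>

lemma energy_form_degenerate:
  assumes C: "elasticity_tensor Y C" and w: "\<And>n. w n \<in> H1 Y"
    and le: "(\<Sum>n\<in>UNIV. \<Sum>m\<in>UNIV. a n * a m * energy_form Y C (w n) (w m)) \<le> 0"
    and v: "v \<in> H1 Y"
  shows "(\<Sum>n\<in>(UNIV::'n::finite set). a n * energy_form Y C (w n) v) = 0"
proof -
  define G where "G y = (\<lambda>i j. \<Sum>n\<in>UNIV. a n * grad Y (w n) y i j)" for y
  have left: "tensor_form (C y) (G y) H = (\<Sum>n\<in>UNIV. a n * tensor_form (C y) (grad Y (w n) y) H)" for y H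
    unfolding G_def by (rule tensor_form_sum_left)
  have intv: "integrable (lebesgue_on Y) (\<lambda>y. tensor_form (C y) (G y) (grad Y u y))"
    and eqv: "(\<Sum>n\<in>UNIV. a n * energy_form Y C (w n) u)
      = (\<integral>y. tensor_form (C y) (G y) (grad Y u y) \<partial>lebesgue_on Y)"
    if "u \<in> H1 Y" for u
    unfolding left energy_form_eq using integrable_energy_density[OF C w that] by simp_all
  from C obtain \<kappa> where "\<kappa> > 0" and coercive: "AE y in lebesgue_on Y. \<forall>\<epsilon>. (\<forall>i j. \<epsilon> i j = \<epsilon> j i) \<longrightarrow>
      tensor_form (C y) \<epsilon> \<epsilon> \<ge> \<kappa> * (\<Sum>i\<in>UNIV. \<Sum>j\<in>UNIV. (\<epsilon> i j)\<^sup>2)"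
    unfolding elasticity_tensor_def tensor_form_def by blast
  have pos: "AE y in lebesgue_on Y. tensor_form (C y) (G y) (G y) \<ge> 0 \<and>
      (tensor_form (C y) (G y) (G y) = 0 \<longrightarrow> (\<forall>H. tensor_form (C y) (G y) H = 0))"
    using elasticity_tensor_symmetric[OF C] coercive
    by eventually_elim (use tensor_form_coercive[OF _ \<open>\<kappa> > 0\<close>] in blast)
  let ?q = "\<lambda>y. \<Sum>m\<in>UNIV. a m * tensor_form (C y) (G y) (grad Y (w m) y)"
  have q: "AE y in lebesgue_on Y. tensor_form (C y) (G y) (G y) = ?q y"
    using elasticity_tensor_symmetric[OF C]
  proof eventually_elim
    case (elim y)
    have "tensor_form (C y) (grad Y (w m) y) (G y) = tensor_form (C y) (G y) (grad Y (w m) y)" for m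
      by (rule tensor_form_commute[OF elim])
    then show ?case using left[of y "G y"] by simp
  qed
  have intq: "integrable (lebesgue_on Y) ?q"
    using intv[OF w] by simp
  have "integral\<^sup>L (lebesgue_on Y) ?q = (\<Sum>m\<in>UNIV. a m * (\<Sum>n\<in>UNIV. a n * energy_form Y C (w n) (w m)))"
    unfolding eqv[OF w] using intv[OF w] by simp
  also have "\<dots> = (\<Sum>n\<in>UNIV. \<Sum>m\<in>UNIV. a n * a m * energy_form Y C (w n) (w m))"
    by (subst sum.swap) (simp add: sum_distrib_left mult_ac)
  finally have "integral\<^sup>L (lebesgue_on Y) ?q \<le> 0" using le by simp
  moreover have q0: "AE y in lebesgue_on Y. ?q y \<ge> 0"
    using q pos by eventually_elim simp
  ultimately have "integral\<^sup>L (lebesgue_on Y) ?q = 0"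
    using integral_nonneg_AE[OF q0] by simp
  then have "AE y in lebesgue_on Y. ?q y = 0"
    using integral_nonneg_eq_0_iff_AE[OF intq q0] by simp
  then have "AE y in lebesgue_on Y. tensor_form (C y) (G y) (grad Y v y) = 0"
    using q pos by eventually_elim simp
  then show ?thesis unfolding eqv[OF v] by (rule integral_eq_zero_AE)
qed

section \<open>Calculus of smooth functions\<close>

lemma partial_deriv_eq:
  "(f has_derivative D) (at x) \<Longrightarrow> partial_deriv j f x = D (axis j 1)"
  by (simp add: partial_deriv_def frechet_derivative_at[symmetric])

lemma partial_deriv_cong_open:
  assumes "open U" "x \<in> U" "\<And>y. y \<in> U \<Longrightarrow> f y = g y"
  shows "partial_deriv j f x = partial_deriv j g x"
proof -
  have "(f has_derivative D) (at x) \<longleftrightarrow> (g has_derivative D) (at x)" for D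
    using has_derivative_transform_within_open[OF _ assms(1,2), of f D UNIV g]
      has_derivative_transform_within_open[OF _ assms(1,2), of g D UNIV f] assms(3) by auto
  then show ?thesis by (simp add: partial_deriv_def frechet_derivative_def)
qed

lemma Ck_Suc_imp_Ck: "Ck (Suc k) f \<Longrightarrow> Ck k f"
proof (induction k arbitrary: f)
  case 0
  then show ?case
    by (simp add: continuous_at_imp_continuous_on differentiable_imp_continuous_within)
qed auto

lemma Ck_continuous_on: "Ck k f \<Longrightarrow> continuous_on UNIV f"
  by (induction k) (simp, blast dest: Ck_Suc_imp_Ck)

text \<open>
  Differentiability is local. This lets a function be glued together from smooth pieces.
\<close>

lemma Ck_local:
  assumes "\<And>x. \<exists>U g. open U \<and> x \<in> U \<and> Ck k g \<and> (\<forall>y\<in>U. f y = g y)"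
  shows "Ck k f"
  using assms
proof (induction k arbitrary: f)
  case 0
  have "isCont f x" for x
  proof -
    obtain U g where U: "open U" "x \<in> U" and "Ck 0 g" "\<forall>y\<in>U. f y = g y"
      using 0 by metis
    then have "isCont g x" by (simp add: continuous_on_eq_continuous_at)
    moreover have "\<forall>\<^sub>F y in nhds x. g y = f y"
      using U \<open>\<forall>y\<in>U. f y = g y\<close> by (auto simp: eventually_nhds)
    ultimately show ?thesis using isCont_cong by blast
  qed
  then show ?case by (simp add: continuous_at_imp_continuous_on)
next
  case (Suc k)
  show ?case
    unfolding Ck.simps
  proof (intro conjI allI)
    fix x
    obtain U g where U: "open U" "x \<in> U" and "Ck (Suc k) g" "\<forall>y\<in>U. f y = g y"
      using Suc.prems by metis
    then obtain D where "(g has_derivative D) (at x)"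
      unfolding Ck.simps differentiable_def by blast
    then have "(f has_derivative D) (at x)"
      by (rule has_derivative_transform_within_open[OF _ U]) (use \<open>\<forall>y\<in>U. f y = g y\<close> in auto)
    then show "f differentiable at x" by (auto simp: differentiable_def)
  next
    fix j
    show "Ck k (partial_deriv j f)"
    proof (rule Suc.IH)
      fix x
      obtain U g where U: "open U" "x \<in> U" and "Ck (Suc k) g" "\<forall>y\<in>U. f y = g y"
        using Suc.prems by metis
      then have "Ck k (partial_deriv j g)" by simp
      moreover have "\<forall>y\<in>U. partial_deriv j f y = partial_deriv j g y"
        using partial_deriv_cong_open[OF U(1)] \<open>\<forall>y\<in>U. f y = g y\<close> by blast
      ultimately show "\<exists>U h. open U \<and> x \<in> U \<and> Ck k h \<and> (\<forall>y\<in>U. partial_deriv j f y = h y)"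
        using U by blast
    qed
  qed
qed

lemma partial_deriv_const [simp]: "partial_deriv j (\<lambda>_. c) = (\<lambda>_. 0)"
  by (rule ext, rule partial_deriv_eq[THEN trans, OF has_derivative_const]) simp

lemma Ck_const: "Ck k (\<lambda>_. c)"
  by (induction k arbitrary: c) auto

lemma partial_deriv_add:
  assumes "f differentiable (at x)" "g differentiable (at x)"
  shows "partial_deriv j (\<lambda>x. f x + g x) x = partial_deriv j f x + partial_deriv j g x"
proof -
  obtain D E where D: "(f has_derivative D) (at x)" and E: "(g has_derivative E) (at x)"
    using assms by (auto simp: differentiable_def)
  show ?thesis
    using partial_deriv_eq[OF has_derivative_add[OF D E], of j]
    by (simp add: partial_deriv_eq[OF D] partial_deriv_eq[OF E])
qed

lemma Ck_add: "Ck k f \<Longrightarrow> Ck k g \<Longrightarrow> Ck k (\<lambda>x. f x + g x)"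
proof (induction k arbitrary: f g)
  case (Suc k)
  then have "partial_deriv j (\<lambda>x. f x + g x) = (\<lambda>x. partial_deriv j f x + partial_deriv j g x)" for j
    by (intro ext partial_deriv_add) auto
  with Suc show ?case by auto
qed (auto intro: continuous_intros)

lemma partial_deriv_mult:
  assumes "f differentiable (at x)" "g differentiable (at x)"
  shows "partial_deriv j (\<lambda>x. f x * g x) x = f x * partial_deriv j g x + partial_deriv j f x * g x"
proof -
  obtain D E where D: "(f has_derivative D) (at x)" and E: "(g has_derivative E) (at x)"
    using assms by (auto simp: differentiable_def)
  show ?thesis
    using partial_deriv_eq[OF has_derivative_mult[OF D E], of j]
    by (simp add: partial_deriv_eq[OF D] partial_deriv_eq[OF E])
qed

lemma Ck_mult: "Ck k f \<Longrightarrow> Ck k g \<Longrightarrow> Ck k (\<lambda>x. f x * g x)"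
proof (induction k arbitrary: f g)
  case (Suc k)
  from Suc.prems have "Ck k f" "Ck k g" by (blast dest: Ck_Suc_imp_Ck)+
  have "partial_deriv j (\<lambda>x. f x * g x) = (\<lambda>x. f x * partial_deriv j g x + partial_deriv j f x * g x)" for j
    using Suc.prems by (intro ext partial_deriv_mult) auto
  moreover have "Ck k (\<lambda>x. f x * partial_deriv j g x + partial_deriv j f x * g x)" for j
  proof -
    have f': "Ck k (partial_deriv j f)" and g': "Ck k (partial_deriv j g)"
      using Suc.prems by simp_all
    show ?thesis
      using Suc.IH[OF \<open>Ck k f\<close> g'] Suc.IH[OF f' \<open>Ck k g\<close>] by (rule Ck_add)
  qed
  moreover have "(\<lambda>x. f x * g x) differentiable (at x)" for x
    using Suc.prems by (intro differentiable_mult) simp_all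
  ultimately show ?case by simp
qed (auto intro: continuous_intros)

lemma Ck_prod: "(\<And>i. i \<in> I \<Longrightarrow> Ck k (f i)) \<Longrightarrow> Ck k (\<lambda>x. \<Prod>i\<in>I. f i x)"
  by (induction I rule: infinite_finite_induct) (auto intro: Ck_const Ck_mult)

lemma Ck_translate: "Ck k f \<Longrightarrow> Ck k (\<lambda>x. f (x + a))"
proof (induction k arbitrary: f)
  case 0
  have "continuous_on UNIV (\<lambda>x. x + a)" by (intro continuous_intros)
  then show ?case
    using 0 continuous_on_compose2[of UNIV f UNIV "\<lambda>x. x + a"] by simp
next
  case (Suc k)
  have D: "((\<lambda>x. f (x + a)) has_derivative D) (at x)" if "(f has_derivative D) (at (x + a))" for D x
    using has_derivative_compose[OF has_derivative_add_const[OF has_derivative_ident, of a] that]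
    by simp
  have "(\<lambda>x. f (x + a)) differentiable (at x)"
    and "partial_deriv j (\<lambda>x. f (x + a)) x = partial_deriv j f (x + a)" for x j
  proof -
    obtain E where E: "(f has_derivative E) (at (x + a))"
      using Suc.prems by (auto simp: differentiable_def)
    from D[OF E] show "(\<lambda>x. f (x + a)) differentiable (at x)" by (auto simp: differentiable_def)
    show "partial_deriv j (\<lambda>x. f (x + a)) x = partial_deriv j f (x + a)"
      using D[OF E] E by (simp add: partial_deriv_eq)
  qed
  moreover from this have "partial_deriv j (\<lambda>x. f (x + a)) = (\<lambda>x. partial_deriv j f (x + a))" for j
    by blast
  ultimately show ?case using Suc by simp
qed

lemma smooth_imp_continuous_on: "smooth f \<Longrightarrow> continuous_on S f"
  unfolding smooth_def by (blast intro: Ck_continuous_on[of 0] continuous_on_subset[of UNIV])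

lemma smooth_imp_Ck: "smooth f \<Longrightarrow> Ck k f"
  by (simp add: smooth_def)

lemma smooth_differentiable: "smooth f \<Longrightarrow> f differentiable (at x)"
  using smooth_imp_Ck[of f "Suc 0"] by simp

lemma smooth_partial_deriv: "smooth f \<Longrightarrow> smooth (partial_deriv j f)"
  unfolding smooth_def using Ck.simps(2) by blast

lemma smooth_mult: "smooth f \<Longrightarrow> smooth g \<Longrightarrow> smooth (\<lambda>x. f x * g x)"
  by (simp add: smooth_def Ck_mult)

section \<open>Smooth cutoff functions\<close>

text \<open>
  The classical flat function \<open>exp (-1/t)\<close> extended by zero, with a power of \<open>t\<close> in the denominator:
  the derivative of a member of this family is again a combination of members, which gives smoothness
  by induction without formulas for the higher derivatives.
\<close>

definition flat :: "nat \<Rightarrow> real \<Rightarrow> real" where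
  "flat m t = (if t \<le> 0 then 0 else exp (- 1 / t) / t ^ m)"

lemma flat_tendsto_0: "(flat m \<longlongrightarrow> 0) (at 0)"
proof (rule filterlim_split_at)
  have "\<forall>\<^sub>F t in at_left (0::real). flat m t = 0"
    by (auto simp: eventually_at_filter flat_def)
  then show "(flat m \<longlongrightarrow> 0) (at_left 0)"
    by (simp add: tendsto_eventually)
  have "((\<lambda>t. inverse t ^ m / exp (inverse t)) \<longlongrightarrow> 0) (at_right (0::real))"
    by (rule filterlim_compose[OF tendsto_power_div_exp_0 filterlim_inverse_at_top_right])
  moreover have "\<forall>\<^sub>F t in at_right (0::real). inverse t ^ m / exp (inverse t) = flat m t"
    by (auto simp: eventually_at_filter flat_def field_simps exp_minus)
  ultimately show "(flat m \<longlongrightarrow> 0) (at_right 0)"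
    by (rule Lim_transform_eventually)
qed

lemma flat_has_derivative:
  "(flat m has_real_derivative (flat (m + 2) t - m * flat (m + 1) t)) (at t)"
proof -
  consider "t < 0" | "t = 0" | "t > 0" by linarith
  then show ?thesis
  proof cases
    case 1
    have "((\<lambda>_. 0) has_real_derivative 0) (at t)" by simp
    then have "(flat m has_real_derivative 0) (at t)"
      by (rule DERIV_cong_ev[THEN iffD1, rotated -1])
        (use 1 in \<open>auto simp: flat_def eventually_nhds intro!: exI[of _ "{..<0}"]\<close>)
    with 1 show ?thesis by (simp add: flat_def)
  next
    case 2
    have "\<forall>\<^sub>F t in at 0. flat (m + 1) t = (flat m t - flat m 0) / (t - 0)"
      by (auto simp: eventually_at_filter flat_def)
    with flat_tendsto_0[of "m + 1"] have "((\<lambda>t. (flat m t - flat m 0) / (t - 0)) \<longlongrightarrow> 0) (at 0)"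
      by (rule Lim_transform_eventually)
    with 2 show ?thesis by (simp add: has_field_derivative_iff flat_def)
  next
    case 3
    have "((\<lambda>t. exp (- 1 / t)) has_real_derivative exp (- 1 / t) / t\<^sup>2) (at t)"
      using 3 by (auto intro!: derivative_eq_intros simp: power2_eq_square)
    moreover have "((\<lambda>t. t ^ m) has_real_derivative m * t ^ m / t) (at t)"
    proof -
      have "m * t ^ m / t = m * t ^ (m - Suc 0)" using 3 by (cases m) auto
      then show ?thesis by (simp only: DERIV_pow)
    qed
    ultimately have "((\<lambda>t. exp (- 1 / t) / t ^ m) has_real_derivative
        (exp (- 1 / t) / t\<^sup>2 * t ^ m - exp (- 1 / t) * (m * t ^ m / t)) / (t ^ m * t ^ m)) (at t)"
      using 3 by (intro DERIV_divide) auto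
    also have "(exp (- 1 / t) / t\<^sup>2 * t ^ m - exp (- 1 / t) * (m * t ^ m / t)) / (t ^ m * t ^ m)
        = flat (m + 2) t - m * flat (m + 1) t"
      using 3 by (simp add: flat_def divide_simps power2_eq_square) (simp add: algebra_simps)
    finally have "((\<lambda>t. exp (- 1 / t) / t ^ m) has_real_derivative
        (flat (m + 2) t - m * flat (m + 1) t)) (at t)" .
    then show ?thesis
      by (rule DERIV_cong_ev[THEN iffD1, rotated -1])
        (use 3 in \<open>auto simp: flat_def eventually_nhds intro!: exI[of _ "{0<..}"]\<close>)
  qed
qed

lemma Ck_flat: "Ck k (\<lambda>x. flat m (c * x $ i + e))"
proof (induction k arbitrary: m)
  case 0
  have "isCont (flat m) t" for t
    using flat_has_derivative by (rule DERIV_isCont)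
  then have "continuous_on UNIV (flat m)" by (simp add: continuous_at_imp_continuous_on)
  moreover have "continuous_on UNIV (\<lambda>x. c * x $ i + e)"
    by (intro continuous_intros)
  ultimately have "continuous_on UNIV (\<lambda>x. flat m (c * x $ i + e))"
    by (rule continuous_on_compose2) simp
  then show ?case by simp
next
  case (Suc k)
  let ?d = "\<lambda>x. flat (m + 2) (c * x $ i + e) - m * flat (m + 1) (c * x $ i + e)"
  have "((\<lambda>x. c * x $ i + e) has_derivative (\<lambda>h. c * h $ i)) (at x)" for x :: "real ^ 'a"
    by (auto intro!: derivative_eq_intros bounded_linear_imp_has_derivative bounded_linear_vec_nth)
  from has_derivative_compose[OF this flat_has_derivative[unfolded has_field_derivative_def]]
  have D: "((\<lambda>x. flat m (c * x $ i + e)) has_derivative (\<lambda>h. ?d x * (c * h $ i))) (at x)" for x :: "real ^ 'a"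
    by simp
  have "partial_deriv j (\<lambda>x. flat m (c * x $ i + e))
      = (\<lambda>x. (c * axis j 1 $ i) * flat (m + 2) (c * x $ i + e)
          + (- m * (c * axis j 1 $ i)) * flat (m + 1) (c * x $ i + e))" for j
    unfolding fun_eq_iff partial_deriv_eq[OF D] by (simp add: algebra_simps)
  moreover have "Ck k (\<lambda>x. (c * axis j 1 $ i) * flat (m + 2) (c * x $ i + e)
          + (- m * (c * axis j 1 $ i)) * flat (m + 1) (c * x $ i + e))" for j
    by (intro Ck_add Ck_mult Ck_const Suc.IH)
  moreover have "(\<lambda>x. flat m (c * x $ i + e)) differentiable (at x)" for x :: "real ^ 'a"
    unfolding differentiable_def using D by blast
  ultimately show ?case by simp
qed

text \<open>
  The shift by \<open>1\<close> keeps the support at distance \<open>1/n\<close> from the faces, hence compact inside the open box,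
  and disappears in the limit.
\<close>

definition box_cutoff :: "real ^ 'd::finite \<Rightarrow> real ^ 'd \<Rightarrow> nat \<Rightarrow> 'd scalar_field" where
  "box_cutoff a b n x =
     (\<Prod>i\<in>UNIV. flat 0 (real n * (x $ i - a $ i) - 1) * flat 0 (real n * (b $ i - x $ i) - 1))"

lemma smooth_box_cutoff: "smooth (box_cutoff a b n)"
proof -
  have eq: "box_cutoff a b n = (\<lambda>x. \<Prod>i\<in>UNIV. flat 0 (real n * x $ i + (- real n * a $ i - 1))
      * flat 0 (- real n * x $ i + (real n * b $ i - 1)))"
    by (auto simp: box_cutoff_def algebra_simps)
  show ?thesis
    unfolding smooth_def eq by (intro allI Ck_prod Ck_mult Ck_flat)
qed

lemma flat_0_bounds: "0 \<le> flat 0 t" "flat 0 t \<le> 1"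
  by (auto simp: flat_def)

lemma flat_0_scaled_tendsto:
  "(\<lambda>n. flat 0 (real n * s - 1)) \<longlonglongrightarrow> (if s > 0 then 1 else 0)"
proof (cases "s > 0")
  case True
  have lim: "filterlim (\<lambda>n. real n * s - 1) at_top sequentially"
    unfolding filterlim_at_top
  proof
    fix u
    show "\<forall>\<^sub>F n in sequentially. u \<le> real n * s - 1"
    proof (rule eventually_sequentiallyI)
      fix n assume "n \<ge> nat \<lceil>(u + 1) / s\<rceil>"
      then have "(u + 1) / s \<le> real n" by linarith
      then show "u \<le> real n * s - 1" using True by (simp add: field_simps)
    qed
  qed
  have "((\<lambda>n. exp (- 1 / (real n * s - 1))) \<longlongrightarrow> exp 0) sequentially"
    by (intro tendsto_exp tendsto_divide_0[OF tendsto_const] filterlim_at_top_imp_at_infinity lim)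
  moreover have "\<forall>\<^sub>F n in sequentially. exp (- 1 / (real n * s - 1)) = flat 0 (real n * s - 1)"
    using filterlim_at_top_dense[THEN iffD1, OF lim, rule_format, of 0]
    by eventually_elim (simp add: flat_def)
  ultimately show ?thesis using True by (simp add: Lim_transform_eventually)
next
  case False
  then have "real n * s - 1 \<le> 0" for n
    using mult_nonneg_nonpos[of "real n" s] by simp
  then show ?thesis using False by (simp add: flat_def)
qed

lemma box_cutoff_tendsto: "(\<lambda>n. box_cutoff a b n x) \<longlonglongrightarrow> indicator (box a b) x"
proof -
  have "(\<lambda>n. box_cutoff a b n x) \<longlonglongrightarrow>
      (\<Prod>i\<in>UNIV. (if x $ i - a $ i > 0 then 1 else 0) * (if b $ i - x $ i > 0 then 1 else 0))"
    unfolding box_cutoff_def by (intro tendsto_prod tendsto_mult flat_0_scaled_tendsto)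
  also have "(\<Prod>i\<in>UNIV. (if x $ i - a $ i > 0 then 1 else 0) * (if b $ i - x $ i > 0 then 1 else (0::real)))
      = indicator (box a b) x"
    by (auto simp: indicator_def mem_box_cart prod_zero_iff intro!: prod.neutral)
  finally show ?thesis .
qed

lemma box_cutoff_bounds: "\<bar>box_cutoff a b n x\<bar> \<le> 1"
proof -
  have "0 \<le> box_cutoff a b n x" "box_cutoff a b n x \<le> 1"
    unfolding box_cutoff_def
    by (auto intro!: prod_nonneg prod_le_1 mult_nonneg_nonneg mult_le_one flat_0_bounds)
  then show ?thesis by simp
qed

lemma test_function_box_cutoff:
  assumes "box a b \<subseteq> Y"
  shows "test_function Y (box_cutoff a b n)"
proof (cases "n = 0")
  (* For n = 0 every factor is flat 0 (-1) = 0. *)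
  case True
  then have "box_cutoff a b n = (\<lambda>_. 0)"
    by (auto simp: box_cutoff_def flat_def)
  then show ?thesis
    unfolding test_function_def using smooth_box_cutoff[of a b n] by (auto intro!: exI[of _ "{}"])
next
  case False
  let ?K = "cbox (\<chi> i. a $ i + 1 / real n) (\<chi> i. b $ i - 1 / real n)"
  have "?K \<subseteq> box a b"
  proof
    fix x assume x: "x \<in> ?K"
    have pos: "1 / real n > 0" using False by simp
    have "a $ i < x $ i \<and> x $ i < b $ i" for i
    proof -
      have "a $ i + 1 / real n \<le> x $ i" "x $ i \<le> b $ i - 1 / real n"
        using x by (auto simp: mem_box_cart)
      then show ?thesis using pos by linarith
    qed
    then show "x \<in> box a b" by (simp add: mem_box_cart)
  qed
  moreover have "box_cutoff a b n x = 0" if "x \<notin> ?K" for x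
  proof -
    obtain i where "x $ i < a $ i + 1 / real n \<or> b $ i - 1 / real n < x $ i"
      using \<open>x \<notin> ?K\<close> by (auto simp: mem_box_cart not_le)
    then have "real n * (x $ i - a $ i) - 1 \<le> 0 \<or> real n * (b $ i - x $ i) - 1 \<le> 0"
      using False by (auto simp: field_simps)
    then show ?thesis
      unfolding box_cutoff_def by (intro prod_zero bexI[of _ i]) (auto simp: flat_def)
  qed
  ultimately show ?thesis
    unfolding test_function_def using assms
    by (intro conjI smooth_box_cutoff exI[of _ ?K] compact_cbox) auto
qed

section \<open>The fundamental lemma of the calculus of variations\<close>

text \<open>
  Open boxes generate the Borel sets and are stable under intersection, so all Borel sets have
  integral zero. The whole space is not a box, whence the separate hypothesis on the total integral;
  it is needed to pass to complements.
\<close>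

lemma AE_eq_0_if_box_integrals_eq_0:
  fixes H :: "'a::euclidean_space \<Rightarrow> real"
  assumes H: "integrable lborel H" and box: "\<And>c d. (\<integral>x. indicator (box c d) x * H x \<partial>lborel) = 0"
    and total: "integral\<^sup>L lborel H = 0"
  shows "AE x in lborel. H x = 0"
proof (rule density_unique_real[OF H])
  have ind: "integrable lborel (\<lambda>x. indicator A x * H x)" if "A \<in> sets borel" for A
    using integrable_mult_indicator[OF _ H, of A] that by simp
  fix A :: "'a set" assume "A \<in> sets lborel"
  then have A: "A \<in> sigma_sets UNIV (range (\<lambda>(a, b). box a b))"
    by (simp add: borel_eq_box)
  have "Int_stable (range (\<lambda>(a, b). box a b :: 'a set))"
    by (auto simp: Int_stable_def box_Int_box)
  moreover have "range (\<lambda>(a, b). box a b :: 'a set) \<subseteq> Pow UNIV" by simp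
  moreover note A
  ultimately have "(\<integral>x. indicator A x * H x \<partial>lborel) = 0"
  proof (induction rule: sigma_sets_induct_disjoint)
    case (basic A)
    then show ?case using box by auto
  next
    case (compl A)
    then have A: "A \<in> sets borel" by (simp add: borel_eq_box)
    have "(\<lambda>x. indicator (UNIV - A) x * H x) = (\<lambda>x. H x - indicator A x * H x)"
      by (auto simp: indicator_def)
    then show ?case using compl ind[OF A] H total by simp
  next
    case (union F)
    then have F: "range F \<subseteq> sets borel" by (simp add: borel_eq_box)
    then have "set_integrable lborel (\<Union>i. F i) H"
      using ind by (simp add: set_integrable_def image_subset_iff sets.countable_UN)
    then have "(LINT x:(\<Union>i. F i)|lborel. H x) = (\<Sum>i. (LINT x:F i|lborel. H x))"
      using F union(1) by (intro lebesgue_integral_countable_add) (auto simp: disjoint_family_on_def)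
    then show ?case using union by (simp add: set_lebesgue_integral_def)
  qed simp
  then show "(LINT x:A|lborel. H x) = (LINT x:A|lborel. 0)"
    by (simp add: set_lebesgue_integral_def)
qed simp

lemma integral_lebesgue_on_eq:
  "Y \<in> sets lebesgue \<Longrightarrow> (\<integral>y. f y \<partial>lebesgue_on Y) = (\<integral>y. indicator Y y * f y \<partial>lebesgue)"
  for f :: "'a::euclidean_space \<Rightarrow> real"
  by (simp add: integral_restrict_space)

text \<open>
  Smooth cutoffs converge boundedly to the indicator of any open box inside \<open>Y\<close>. So \<open>g\<close> integrates
  to zero over each such box, hence vanishes almost everywhere on it, and countably many of them
  cover \<open>Y\<close>.
\<close>

lemma AE_eq_0_if_orthogonal_to_test_functions:
  assumes Y: "open Y" and g: "integrable (lebesgue_on Y) g"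
    and orth: "\<And>\<psi>. test_function Y \<psi> \<Longrightarrow> (\<integral>y. g y * \<psi> y \<partial>lebesgue_on Y) = 0"
  shows "AE y in lebesgue_on Y. g y = 0"
proof -
  have [simp]: "Y \<in> sets lebesgue" using Y by (intro sets_completionI_sets) simp
  have int_box: "(\<integral>y. indicator (box a b) y * g y \<partial>lebesgue_on Y) = 0" if "box a b \<subseteq> Y" for a b
  proof -
    have "(\<lambda>n. \<integral>y. g y * box_cutoff a b n y \<partial>lebesgue_on Y) \<longlonglongrightarrow> (\<integral>y. indicator (box a b) y * g y \<partial>lebesgue_on Y)"
    proof (rule integral_dominated_convergence)
      show "integrable (lebesgue_on Y) (\<lambda>y. \<bar>g y\<bar>)" using g by simp
      have [measurable]: "g \<in> borel_measurable (lebesgue_on Y)" using g by simp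
      show "(\<lambda>y. indicator (box a b) y * g y) \<in> borel_measurable (lebesgue_on Y)"
        using that by (intro borel_measurable_times borel_measurable_indicator)
          (auto simp: sets_restrict_space_iff)
      have "box_cutoff a b n \<in> borel_measurable (lebesgue_on Y)" for n
        by (intro continuous_imp_measurable_on_sets_lebesgue smooth_imp_continuous_on smooth_box_cutoff) simp
      then show "(\<lambda>y. g y * box_cutoff a b n y) \<in> borel_measurable (lebesgue_on Y)" for n
        by measurable
      show "AE y in lebesgue_on Y. (\<lambda>n. g y * box_cutoff a b n y) \<longlonglongrightarrow> indicator (box a b) y * g y"
        by (intro AE_I2) (subst mult.commute, intro tendsto_mult box_cutoff_tendsto tendsto_const)
      show "AE y in lebesgue_on Y. norm (g y * box_cutoff a b n y) \<le> \<bar>g y\<bar>" for n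
        using mult_left_mono[OF box_cutoff_bounds[of a b n]] by (auto simp: abs_mult)
    qed
    moreover have "(\<integral>y. g y * box_cutoff a b n y \<partial>lebesgue_on Y) = 0" for n
      by (intro orth test_function_box_cutoff that)
    ultimately show ?thesis by (simp add: LIMSEQ_const_iff)
  qed
  have "integrable lebesgue (\<lambda>y. indicator Y y * g y)"
    using g by (simp add: integrable_restrict_space)
  (* A Borel version of g, because boxes generate the Borel sets and not all Lebesgue sets. *)
  then obtain G where G: "G \<in> borel_measurable lborel" and eq: "AE y in lborel. indicator Y y * g y = G y"
    using completion_ex_borel_measurable_real[of "\<lambda>y. indicator Y y * g y" lborel] by auto
  have eq': "AE y in lebesgue. indicator Y y * g y = G y"
    using eq by (rule AE_completion)
  have "integrable lebesgue G"
    by (rule integrable_cong_AE_imp[OF \<open>integrable lebesgue (\<lambda>y. indicator Y y * g y)\<close>])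
      (use G eq' in \<open>auto simp: measurable_completion\<close>)
  then have intG: "integrable lborel G"
    using G by (simp add: integrable_completion)
  have G_box: "(\<integral>y. indicator (box a b) y * G y \<partial>lborel) = 0" if "box a b \<subseteq> Y" for a b
  proof -
    have "(\<integral>y. indicator (box a b) y * G y \<partial>lborel) = (\<integral>y. indicator (box a b) y * G y \<partial>lebesgue)"
      using G by (subst integral_completion) auto
    also have "\<dots> = (\<integral>y. indicator (box a b) y * (indicator Y y * g y) \<partial>lebesgue)"
    proof (rule integral_cong_AE)
      show "(\<lambda>y. indicator (box a b) y * G y) \<in> borel_measurable lebesgue"
        using G by (intro measurable_completion) auto
      show "(\<lambda>y. indicator (box a b) y * (indicator Y y * g y)) \<in> borel_measurable lebesgue"
        by (rule borel_measurable_times[OF borel_measurable_indicator borel_measurable_integrable])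
          (simp_all add: \<open>integrable lebesgue (\<lambda>y. indicator Y y * g y)\<close>)
      show "AE y in lebesgue. indicator (box a b) y * G y = indicator (box a b) y * (indicator Y y * g y)"
        using eq' by eventually_elim simp
    qed
    also have "\<dots> = (\<integral>y. indicator (box a b) y * g y \<partial>lebesgue_on Y)"
      by (simp add: integral_lebesgue_on_eq mult_ac)
    finally show ?thesis using int_box[OF that] by simp
  qed
  have G_0: "AE y in lborel. y \<in> box a b \<longrightarrow> G y = 0" if "box a b \<subseteq> Y" for a b
  proof -
    have "AE y in lborel. indicator (box a b) y * G y = 0"
    proof (rule AE_eq_0_if_box_integrals_eq_0)
      show "integrable lborel (\<lambda>y. indicator (box a b) y * G y)"
        using integrable_mult_indicator[OF _ intG, of "box a b"] by simp
      show "(\<integral>y. indicator (box a b) y * G y \<partial>lborel) = 0" by (rule G_box[OF that])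
      fix c d
      obtain p q where pq: "box c d \<inter> box a b = box p q" by (auto simp: box_Int_box)
      have "(\<lambda>y. indicator (box c d) y * (indicator (box a b) y * G y)) = (\<lambda>y. indicator (box p q) y * G y)"
        unfolding pq[symmetric] by (simp add: indicator_inter_arith mult.assoc)
      moreover have "box p q \<subseteq> Y" using pq that by blast
      ultimately show "(\<integral>y. indicator (box c d) y * (indicator (box a b) y * G y) \<partial>lborel) = 0"
        using G_box by simp
    qed
    then show ?thesis by eventually_elim auto
  qed
  obtain \<D> where "countable \<D>" and \<D>: "\<D> \<subseteq> Pow Y" "\<And>X. X \<in> \<D> \<Longrightarrow> \<exists>a b. X = box a b" "\<Union>\<D> = Y"
    using open_countable_Union_open_box[OF Y] by metis
  have "AE y in lborel. y \<in> X \<longrightarrow> G y = 0" if X: "X \<in> \<D>" for X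
  proof -
    obtain a b where "X = box a b" using \<D>(2)[OF X] by blast
    moreover have "X \<subseteq> Y" using \<D>(1) X by blast
    ultimately show ?thesis using G_0 by simp
  qed
  then have "AE y in lborel. \<forall>X\<in>\<D>. y \<in> X \<longrightarrow> G y = 0"
    by (subst AE_ball_countable[OF \<open>countable \<D>\<close>]) blast
  then have "AE y in lebesgue. \<forall>X\<in>\<D>. y \<in> X \<longrightarrow> G y = 0"
    by (rule AE_completion)
  with eq' have "AE y in lebesgue. y \<in> Y \<longrightarrow> g y = 0"
  proof eventually_elim
    case (elim y)
    show ?case
    proof
      assume "y \<in> Y"
      moreover from this obtain X where "X \<in> \<D>" "y \<in> X" using \<D>(3) by blast
      ultimately show "g y = 0" using elim by simp
    qed
  qed
  then show ?thesis by (simp add: AE_restrict_space_iff)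
qed

section \<open>Weak derivatives of smooth functions\<close>

lemma integral_translation: "(\<integral>x. f (x + c) \<partial>lborel) = (\<integral>x. f x \<partial>lborel)"
  if "f \<in> borel_measurable borel" for f :: "'a::euclidean_space \<Rightarrow> real"
proof -
  have "(\<integral>x. f x \<partial>lborel) = (\<integral>x. f x \<partial>distr lborel borel ((+) c))"
    by (simp add: lborel_distr_plus)
  also have "\<dots> = (\<integral>x. f (c + x) \<partial>lborel)"
    using that by (intro integral_distr) auto
  finally show ?thesis by (simp add: add.commute)
qed

lemma partial_deriv_eq_0_outside_support:
  assumes "closed K" "\<And>x. x \<notin> K \<Longrightarrow> u x = 0" "x \<notin> K"
  shows "partial_deriv j u x = 0"
  using partial_deriv_cong_open[of "- K" x u "\<lambda>_. 0" j] assms by (simp add: open_Compl)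

lemma directional_derivative:
  assumes "u differentiable (at (x + t *\<^sub>R axis j 1))"
  shows "((\<lambda>s. u (x + s *\<^sub>R axis j 1)) has_real_derivative partial_deriv j u (x + t *\<^sub>R axis j 1)) (at t)"
proof -
  obtain D where D: "(u has_derivative D) (at (x + t *\<^sub>R axis j 1))"
    using assms by (auto simp: differentiable_def)
  have "((\<lambda>s. x + s *\<^sub>R axis j 1) has_derivative (\<lambda>s. s *\<^sub>R axis j 1)) (at t)"
    by (auto intro!: derivative_eq_intros)
  from has_derivative_compose[OF this D]
  have "((\<lambda>s. u (x + s *\<^sub>R axis j 1)) has_derivative (\<lambda>s. D (s *\<^sub>R axis j 1))) (at t)" .
  moreover have "D (s *\<^sub>R axis j 1) = partial_deriv j u (x + t *\<^sub>R axis j 1) * s" for s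
    using linear_cmul[OF has_derivative_linear[OF D]] by (simp add: partial_deriv_eq[OF D])
  ultimately show ?thesis by (simp add: has_field_derivative_def)
qed

text \<open>
  Translation does not change the integral of \<open>u\<close>, so all difference quotients of \<open>u\<close> integrate to zero.
  By the mean value theorem they are bounded by the maximum of the derivative on a fixed ball, and
  dominated convergence passes to the limit.
\<close>

lemma integral_partial_deriv_eq_0:
  assumes u: "smooth u" and K: "compact K" and u0: "\<And>x. x \<notin> K \<Longrightarrow> u x = 0"
  shows "(\<integral>x. partial_deriv j u x \<partial>lborel) = 0"
proof -
  let ?e = "axis j 1 :: real ^ 'a"
  let ?h = "\<lambda>n. 1 / real (Suc n)"
  define q where "q n x = (u (x + ?h n *\<^sub>R ?e) - u x) / ?h n" for n x
  have cont: "continuous_on UNIV u" "continuous_on UNIV (partial_deriv j u)"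
    using u smooth_partial_deriv smooth_imp_continuous_on by blast+
  then have [measurable]: "u \<in> borel_measurable borel" "partial_deriv j u \<in> borel_measurable borel"
    by (simp_all add: borel_measurable_continuous_onI)
  have d0: "partial_deriv j u x = 0" if "x \<notin> K" for x
    using partial_deriv_eq_0_outside_support[OF compact_imp_closed[OF K] u0 that] .
  have "compact (partial_deriv j u ` K)"
    using K cont(2) by (meson compact_continuous_image continuous_on_subset subset_UNIV)
  then obtain B' where "\<forall>x\<in>K. \<bar>partial_deriv j u x\<bar> \<le> B'"
    by (auto dest!: compact_imp_bounded simp: bounded_iff)
  with d0 have B: "\<bar>partial_deriv j u x\<bar> \<le> max 0 B'" for x
    by (cases "x \<in> K") (auto simp: le_max_iff_disj)
  obtain R where R: "\<And>x. x \<in> K \<Longrightarrow> norm x \<le> R"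
    using compact_imp_bounded[OF K] by (auto simp: bounded_iff)
  have q_bound: "\<bar>q n x\<bar> \<le> max 0 B' * indicator (cball 0 (R + 1)) x" for n x
  proof (cases "norm x \<le> R + 1")
    case True
    obtain z where "u (x + ?h n *\<^sub>R ?e) - u (x + 0 *\<^sub>R ?e)
        = (?h n - 0) * partial_deriv j u (x + z *\<^sub>R ?e)"
      using MVT2[of 0 "?h n" "\<lambda>s. u (x + s *\<^sub>R ?e)" "\<lambda>s. partial_deriv j u (x + s *\<^sub>R ?e)"]
        directional_derivative[OF smooth_differentiable[OF u]] by auto
    then have "q n x = partial_deriv j u (x + z *\<^sub>R ?e)" by (simp add: q_def)
    then show ?thesis using B True by simp
  next
    case False
    have "norm (?h n *\<^sub>R ?e) \<le> 1" by (simp add: norm_axis_1)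
    then have "norm (x + ?h n *\<^sub>R ?e) > R"
      using False norm_triangle_ineq2[of x "- (?h n *\<^sub>R ?e)"]
      unfolding norm_minus_cancel diff_minus_eq_add by linarith
    then have "x + ?h n *\<^sub>R ?e \<notin> K" "x \<notin> K" using R False by force+
    then show ?thesis by (simp add: q_def u0)
  qed
  have int_u: "integrable lborel (\<lambda>x. u (x + c))" for c
  proof -
    have "compact ((\<lambda>x. x + - c) ` K)"
      by (intro compact_continuous_image continuous_intros K)
    then have "integrable lborel (\<lambda>x. indicator ((\<lambda>x. x + - c) ` K) x *\<^sub>R u (x + c))"
      by (intro borel_integrable_compact) (auto intro!: continuous_intros continuous_on_compose2[OF cont(1)])
    moreover have "indicator ((\<lambda>x. x + - c) ` K) x *\<^sub>R u (x + c) = u (x + c)" for x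
      using u0[of "x + c"] by (auto simp: indicator_def image_iff) (metis add_diff_cancel_right')
    ultimately show ?thesis by (simp only:)
  qed
  have "(\<lambda>n. \<integral>x. q n x \<partial>lborel) \<longlonglongrightarrow> (\<integral>x. partial_deriv j u x \<partial>lborel)"
  proof (rule integral_dominated_convergence)
    show "integrable lborel (\<lambda>x :: real ^ 'a. max 0 B' * indicator (cball 0 (R + 1)) x)"
      using emeasure_lborel_cball_finite[of "0 :: real ^ 'a" "R + 1"]
      by (intro integrable_mult_right integrable_real_indicator) auto
    show "AE x in lborel. (\<lambda>n. q n x) \<longlonglongrightarrow> partial_deriv j u x"
    proof (rule AE_I2)
      fix x
      have "((\<lambda>s. u (x + s *\<^sub>R ?e)) has_real_derivative partial_deriv j u x) (at 0)"
        using directional_derivative[OF smooth_differentiable[OF u], of x _ 0] by simp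
      then have "((\<lambda>s. (u (x + s *\<^sub>R ?e) - u x) / s) \<longlongrightarrow> partial_deriv j u x) (at 0)"
        by (simp add: has_field_derivative_iff)
      moreover have "filterlim ?h (at 0) sequentially"
        by (rule filterlim_atI[OF LIMSEQ_Suc[OF lim_1_over_n]]) simp
      ultimately show "(\<lambda>n. q n x) \<longlonglongrightarrow> partial_deriv j u x"
        unfolding q_def by (rule filterlim_compose)
    qed
    show "AE x in lborel. norm (q n x) \<le> max 0 B' * indicator (cball 0 (R + 1)) x" for n
      using q_bound by simp
  qed (simp_all add: q_def)
  moreover have "(\<integral>x. q n x \<partial>lborel) = 0" for n
  proof -
    have "(\<integral>x. q n x \<partial>lborel) = ((\<integral>x. u (x + ?h n *\<^sub>R ?e) \<partial>lborel) - (\<integral>x. u x \<partial>lborel)) / ?h n"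
      unfolding q_def using int_u[of "?h n *\<^sub>R ?e"] int_u[of 0] by simp
    then show ?thesis by (simp add: integral_translation)
  qed
  ultimately show ?thesis by (simp add: LIMSEQ_const_iff)
qed

lemma L2_smooth:
  assumes "Y \<in> lmeasurable" "bounded Y" "smooth f"
  shows "L2 Y f"
proof (rule L2_Linf)
  have "compact (f ` closure Y)"
    using assms smooth_imp_continuous_on by (intro compact_continuous_image) (auto simp: compact_closure)
  then obtain B where "\<forall>x\<in>closure Y. \<bar>f x\<bar> \<le> B"
    by (auto dest!: compact_imp_bounded simp: bounded_iff)
  then have "\<forall>x\<in>Y. \<bar>f x\<bar> \<le> B" using closure_subset by blast
  moreover have "f \<in> borel_measurable (lebesgue_on Y)"
    using assms by (intro continuous_imp_measurable_on_sets_lebesgue smooth_imp_continuous_on) auto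
  ultimately show "Linf Y f"
    by (auto simp: Linf_def intro!: exI[of _ B])
qed fact

text \<open>
  Integration by parts: the product with a test function has compact support inside \<open>Y\<close>.
\<close>

lemma smooth_weak_partial:
  assumes Y: "Y \<in> lmeasurable" "bounded Y" and f: "smooth f"
  shows "is_weak_partial Y j f (partial_deriv j f)"
  unfolding is_weak_partial_def
proof (intro allI impI)
  fix \<psi> assume "test_function Y \<psi>"
  then obtain K where \<psi>: "smooth \<psi>" and K: "compact K" "K \<subseteq> Y" and \<psi>0: "\<And>x. x \<notin> K \<Longrightarrow> \<psi> x = 0"
    unfolding test_function_def by blast
  let ?u = "\<lambda>x. f x * \<psi> x"
  have u: "smooth ?u" using f \<psi> by (rule smooth_mult)
  have pd: "partial_deriv j ?u x = f x * partial_deriv j \<psi> x + partial_deriv j f x * \<psi> x" for x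
    by (intro partial_deriv_mult smooth_differentiable f \<psi>)
  have int: "integrable (lebesgue_on Y) (\<lambda>x. f x * partial_deriv j \<psi> x)"
    "integrable (lebesgue_on Y) (\<lambda>x. partial_deriv j f x * \<psi> x)"
    by (intro integrable_L2_mult L2_smooth Y smooth_partial_deriv f \<psi>)+
  have "(\<integral>x. f x * partial_deriv j \<psi> x \<partial>lebesgue_on Y) + (\<integral>x. partial_deriv j f x * \<psi> x \<partial>lebesgue_on Y)
      = (\<integral>x. partial_deriv j ?u x \<partial>lebesgue_on Y)"
    unfolding pd using int by simp
  also have "\<dots> = (\<integral>x. indicator Y x * partial_deriv j ?u x \<partial>lebesgue)"
    using Y by (intro integral_lebesgue_on_eq) auto
  also have "(\<lambda>x. indicator Y x * partial_deriv j ?u x) = partial_deriv j ?u"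
    using partial_deriv_eq_0_outside_support[OF compact_imp_closed[OF K(1)], of ?u _ j] \<psi>0 K(2)
    by (fastforce simp: indicator_def)
  also have "(\<integral>x. partial_deriv j ?u x \<partial>lebesgue) = (\<integral>x. partial_deriv j ?u x \<partial>lborel)"
    using smooth_imp_continuous_on[OF smooth_partial_deriv[OF u]]
    by (intro integral_completion) (simp add: borel_measurable_continuous_onI)
  also have "\<dots> = 0"
    by (rule integral_partial_deriv_eq_0[OF u K(1)]) (simp add: \<psi>0)
  finally show "(\<integral>x. f x * partial_deriv j \<psi> x \<partial>lebesgue_on Y) = - (\<integral>x. partial_deriv j f x * \<psi> x \<partial>lebesgue_on Y)"
    by simp
qed

text \<open>
  The norm contains the weak gradient that \<open>wgrad\<close> selects for the zero field, which is some
  representative of zero; the fundamental lemma identifies it almost everywhere.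
\<close>

lemma H1_norm_zero:
  assumes Y: "Y \<in> lmeasurable" "open Y"
  shows "H1_norm Y (\<lambda>_. 0) = 0"
proof -
  have "is_weak_partial Y j (\<lambda>_. 0) (\<lambda>_. 0)" for j
    by (simp add: is_weak_partial_def)
  then have H1: "(\<lambda>_. 0) \<in> H1 Y"
    unfolding H1_def using L2_zero[of Y] by (simp, blast)
  have "(\<integral>y. (wgrad Y (\<lambda>_. 0) i j y)\<^sup>2 \<partial>lebesgue_on Y) = 0" for i j
  proof -
    have "AE y in lebesgue_on Y. wgrad Y (\<lambda>_. 0) i j y = 0"
    proof (rule AE_eq_0_if_orthogonal_to_test_functions[OF Y(2)])
      show "integrable (lebesgue_on Y) (wgrad Y (\<lambda>_. 0) i j)"
        by (intro integrable_L2 L2_wgrad H1 Y)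
      show "(\<integral>y. wgrad Y (\<lambda>_. 0) i j y * \<psi> y \<partial>lebesgue_on Y) = 0" if "test_function Y \<psi>" for \<psi>
        using wgrad_weak_partial[OF H1, of i j] that by (simp add: is_weak_partial_def)
    qed
    then show ?thesis by (intro integral_eq_zero_AE) (auto elim: eventually_mono)
  qed
  then show ?thesis by (simp add: H1_norm_def)
qed

lemma smooth_periodic_imp_H1_per:
  assumes Y: "Y \<in> lmeasurable" "open Y" "bounded Y" and w: "smooth_periodic Z w"
  shows "w \<in> H1_per Z Y"
proof -
  have smooth: "smooth (\<lambda>y. w y $ i)" for i
    using w by (simp add: smooth_periodic_def)
  have "L2 Y (\<lambda>y. w y $ i)" and "L2 Y (partial_deriv j (\<lambda>y. w y $ i))"
    and "is_weak_partial Y j (\<lambda>y. w y $ i) (partial_deriv j (\<lambda>y. w y $ i))" for i j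
    by (intro L2_smooth smooth_weak_partial smooth_partial_deriv smooth Y)+
  then have "w \<in> H1 Y"
    unfolding H1_def by blast
  moreover have "H1_norm Y (\<lambda>y. w y - w y) = 0"
    using H1_norm_zero[OF Y(1,2)] by simp
  ultimately show ?thesis
    using w unfolding H1_per_def by fastforce
qed

section \<open>Periodic extension of test functions\<close>

text \<open>
  The lattice is the image of the integer points under an injective linear map. Closedness makes the
  translates of a compact set a closed set, which is the local finiteness that the periodic extension
  below requires.
\<close>

lemma closed_lattice:
  assumes "lattice_basis b"
  shows "closed (lattice b)"
proof -
  define L where "L = (\<lambda>x :: real ^ 'a. \<Sum>i\<in>UNIV. (x $ i) *\<^sub>R b i)"
  have "linear L"
    unfolding L_def by (intro linear_compose_sum ballI)
      (auto intro!: linearI simp: scaleR_add_left)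
  moreover have "inj L"
  proof (rule linear_injective_0[OF \<open>linear L\<close>, THEN iffD2], intro allI impI)
    fix x assume "L x = 0"
    have inj: "inj b" and ind: "independent (range b)"
      using assms by (auto simp: lattice_basis_def)
    have "(\<Sum>v\<in>range b. (x $ inv b v) *\<^sub>R v) = 0"
      using \<open>L x = 0\<close> inj by (simp add: sum.reindex L_def)
    then have "x $ inv b (b i) = 0" for i
      using independentD[OF ind, of "range b" "\<lambda>v. x $ inv b v" "b i"] by simp
    then show "x = 0" using inj by (simp add: vec_eq_iff)
  qed
  moreover have "closed {x :: real ^ 'a. \<forall>i. x $ i \<in> \<int>}"
  proof -
    have "closed ((\<lambda>x :: real ^ 'a. x $ i) -` \<int>)" for i
      by (intro closed_vimage closed_Ints continuous_intros)
    then have "closed (\<Inter>i. (\<lambda>x :: real ^ 'a. x $ i) -` \<int>)" by blast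
    moreover have "(\<Inter>i. (\<lambda>x :: real ^ 'a. x $ i) -` \<int>) = {x. \<forall>i. x $ i \<in> \<int>}" by auto
    ultimately show ?thesis by simp
  qed
  ultimately have "closed (L ` {x. \<forall>i. x $ i \<in> \<int>})"
    by (intro closed_injective_linear_image)
  also have "L ` {x. \<forall>i. x $ i \<in> \<int>} = lattice b"
  proof (intro equalityI subsetI)
    fix v assume "v \<in> L ` {x. \<forall>i. x $ i \<in> \<int>}"
    then obtain x where v: "v = L x" and "\<forall>i. x $ i \<in> \<int>" by blast
    then have "\<forall>i. \<exists>m::int. x $ i = of_int m" by (auto elim: Ints_cases)
    then obtain n :: "'a \<Rightarrow> int" where "\<forall>i. x $ i = of_int (n i)" by metis
    with v show "v \<in> lattice b" by (auto simp: lattice_def L_def)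
  next
    fix v assume "v \<in> lattice b"
    then obtain n :: "'a \<Rightarrow> int" where "v = (\<Sum>i\<in>UNIV. of_int (n i) *\<^sub>R b i)"
      by (auto simp: lattice_def)
    then show "v \<in> L ` {x. \<forall>i. x $ i \<in> \<int>}"
      by (intro image_eqI[of _ _ "\<chi> i. of_int (n i)"]) (auto simp: L_def)
  qed
  finally show ?thesis .
qed

lemma lattice_subgroup:
  shows "0 \<in> lattice b" "V \<in> lattice b \<Longrightarrow> W \<in> lattice b \<Longrightarrow> V + W \<in> lattice b"
    "V \<in> lattice b \<Longrightarrow> - V \<in> lattice b"
proof -
  show "0 \<in> lattice b" unfolding lattice_def by (auto intro!: exI[of _ "\<lambda>_. 0"])
  show "V + W \<in> lattice b" if V: "V \<in> lattice b" and W: "W \<in> lattice b"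
  proof -
    obtain m where "V = (\<Sum>i\<in>UNIV. of_int (m i) *\<^sub>R b i)"
      using V by (auto simp: lattice_def)
    moreover obtain n where "W = (\<Sum>i\<in>UNIV. of_int (n i) *\<^sub>R b i)"
      using W by (auto simp: lattice_def)
    ultimately have "V + W = (\<Sum>i\<in>UNIV. of_int (m i + n i) *\<^sub>R b i)"
      by (simp add: scaleR_add_left sum.distrib)
    then show ?thesis unfolding lattice_def by (auto intro!: exI[of _ "\<lambda>i. m i + n i"])
  qed
  show "- V \<in> lattice b" if V: "V \<in> lattice b"
  proof -
    obtain m where "V = (\<Sum>i\<in>UNIV. of_int (m i) *\<^sub>R b i)" using V by (auto simp: lattice_def)
    then have "- V = (\<Sum>i\<in>UNIV. of_int (- m i) *\<^sub>R b i)" by (simp add: sum_negf)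
    then show ?thesis unfolding lattice_def by (auto intro!: exI[of _ "\<lambda>i. - m i"])
  qed
qed

text \<open>
  The translates of the cell are disjoint, so copying \<open>\<psi>\<close> onto each of them is well defined. The copies
  of the support form a closed set that lies inside the open translates of the cell; therefore the
  extension is locally either a translate of \<open>\<psi>\<close> or zero.
\<close>

lemma test_function_periodic_extension:
  assumes Z: "lattice_basis b" "Z = lattice b" and cell: "periodicity_cell Z Y" and \<psi>: "test_function Y \<psi>"
  obtains \<Psi> where "smooth \<Psi>" "\<And>V x. V \<in> Z \<Longrightarrow> \<Psi> (x + V) = \<Psi> x" "\<And>y. y \<in> Y \<Longrightarrow> \<Psi> y = \<psi> y"
proof -
  obtain K where "smooth \<psi>" and K: "compact K" "K \<subseteq> Y" and \<psi>0: "\<And>x. x \<notin> K \<Longrightarrow> \<psi> x = 0"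
    using \<psi> unfolding test_function_def by blast
  have Y: "open Y" and disj: "\<And>V W. V \<in> Z \<Longrightarrow> W \<in> Z \<Longrightarrow> V \<noteq> W \<Longrightarrow> (+) V ` Y \<inter> (+) W ` Y = {}"
    using cell by (auto simp: periodicity_cell_def)
  have unique: "V = W" if "V \<in> Z" "W \<in> Z" "x - V \<in> Y" "x - W \<in> Y" for V W x
  proof (rule ccontr)
    assume "V \<noteq> W"
    moreover have "x \<in> (+) V ` Y" "x \<in> (+) W ` Y"
      using that by (auto intro: image_eqI[of _ _ "x - V"] image_eqI[of _ _ "x - W"])
    ultimately show False using disj that by blast
  qed
  define \<Psi> where "\<Psi> x = (if \<exists>V\<in>Z. x - V \<in> Y then \<psi> (x - (THE V. V \<in> Z \<and> x - V \<in> Y)) else 0)" for x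
  have on_cell: "\<Psi> x = \<psi> (x - V)" if "V \<in> Z" "x - V \<in> Y" for x V
  proof -
    have "(THE V. V \<in> Z \<and> x - V \<in> Y) = V" using that unique by blast
    then show ?thesis using that by (auto simp: \<Psi>_def)
  qed
  have off: "\<Psi> x = 0" if "\<And>V. V \<in> Z \<Longrightarrow> x - V \<notin> K" for x
  proof (cases "\<exists>V\<in>Z. x - V \<in> Y")
    case True
    then show ?thesis using on_cell that \<psi>0 by metis
  qed (simp add: \<Psi>_def)
  show thesis
  proof
    show "\<Psi> y = \<psi> y" if "y \<in> Y" for y
      using on_cell[of 0 y] that lattice_subgroup(1)[of b] Z(2) by simp
    show "\<Psi> (x + V) = \<Psi> x" if V: "V \<in> Z" for x V
    proof (cases "\<exists>W\<in>Z. x - W \<in> Y")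
      case True
      then obtain W where W: "W \<in> Z" "x - W \<in> Y" by blast
      moreover have "W + V \<in> Z" using W V Z lattice_subgroup by blast
      ultimately show ?thesis using on_cell[of "W + V" "x + V"] on_cell[of W x] by simp
    next
      case False
      have "\<not> (\<exists>W\<in>Z. x + V - W \<in> Y)"
      proof
        assume "\<exists>W\<in>Z. x + V - W \<in> Y"
        then obtain W where W: "W \<in> Z" "x + V - W \<in> Y" by blast
        then have "W + - V \<in> Z" using V Z lattice_subgroup by blast
        moreover have "x - (W + - V) \<in> Y" using W by (simp add: algebra_simps)
        ultimately show False using False by blast
      qed
      with False show ?thesis by (simp add: \<Psi>_def)
    qed
    show "smooth \<Psi>"
      unfolding smooth_def
    proof (intro allI Ck_local)
      fix k x
      show "\<exists>U g. open U \<and> x \<in> U \<and> Ck k g \<and> (\<forall>y\<in>U. \<Psi> y = g y)"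
      proof (cases "\<exists>V\<in>Z. x - V \<in> Y")
        case True
        then obtain V where V: "V \<in> Z" "x - V \<in> Y" by blast
        have "open ((\<lambda>y. y - V) -` Y)" using Y by (intro open_vimage continuous_intros)
        moreover have "Ck k (\<lambda>y. \<psi> (y - V))"
          using Ck_translate[OF smooth_imp_Ck[OF \<open>smooth \<psi>\<close>], of k "- V"] by simp
        ultimately show ?thesis using V on_cell by (intro exI[of _ "(\<lambda>y. y - V) -` Y"] exI) auto
      next
        case False
        let ?S = "\<Union>V\<in>Z. \<Union>y\<in>K. {V + y}"
        have "closed ?S"
          unfolding Z(2) by (intro closed_compact_sums closed_lattice Z(1) K(1))
        moreover have "x \<notin> ?S"
          using False K(2) by force
        moreover have "\<Psi> y = 0" if "y \<in> - ?S" for y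
          by (rule off) (use that in force)
        ultimately show ?thesis
          by (intro exI[of _ "- ?S"] exI[of _ "\<lambda>_. 0"]) (auto simp: Ck_const simp del: Compl_UN intro!: open_Compl)
      qed
    qed
  qed
qed

section \<open>Cell functions as test fields\<close>

lemma periodicity_cell_lmeasurable:
  assumes "periodicity_cell Z Y"
  shows "Y \<in> lmeasurable" "measure lebesgue Y > 0"
proof -
  have Y: "open Y" "bounded Y" using assms by (auto simp: periodicity_cell_def)
  then show L: "Y \<in> lmeasurable" by (simp add: lmeasurable_open)
  have "Y \<noteq> {}" using assms by (auto simp: periodicity_cell_def)
  then have "\<not> negligible Y" using Y open_not_negligible by blast
  then show "measure lebesgue Y > 0"
    using L by (simp add: negligible_iff_measure zero_less_measure_iff)
qed

lemma Linf_rel_density: "mass_density Y \<rho> \<Longrightarrow> Linf Y (rel_density Y \<rho>)"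
proof -
  assume "mass_density Y \<rho>"
  then obtain K where m: "\<rho> \<in> borel_measurable (lebesgue_on Y)" and K: "AE y in lebesgue_on Y. \<bar>\<rho> y\<bar> \<le> K"
    by (auto simp: mass_density_def Linf_def)
  from K have "AE y in lebesgue_on Y. \<bar>rel_density Y \<rho> y\<bar> \<le> K / \<bar>cell_avg Y \<rho>\<bar>"
    by eventually_elim (simp add: rel_density_def divide_right_mono)
  with m show ?thesis unfolding Linf_def rel_density_def by auto
qed

text \<open>
  The lower bound on the density makes its mean positive, so the relative density is not a division
  by zero and has mean one.
\<close>

lemma integral_rel_density:
  assumes "Y \<in> lmeasurable" "measure lebesgue Y > 0" "mass_density Y \<rho>"
  shows "(\<integral>y. (rel_density Y \<rho> y - 1) \<partial>lebesgue_on Y) = 0"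
proof -
  interpret finite_measure "lebesgue_on Y"
    using assms(1) by (rule finite_measure_lebesgue_on)
  have m: "measure (lebesgue_on Y) (space (lebesgue_on Y)) = measure lebesgue Y"
    using assms(1) by (simp add: measure_restrict_space fmeasurableD)
  have int: "integrable (lebesgue_on Y) \<rho>"
    using assms(3) by (intro integrable_L2 L2_Linf assms(1)) (simp add: mass_density_def)
  obtain \<rho>m where "\<rho>m > 0" and ge: "AE y in lebesgue_on Y. \<rho> y \<ge> \<rho>m"
    using assms(3) by (auto simp: mass_density_def)
  have "\<rho>m * measure lebesgue Y \<le> (\<integral>y. \<rho> y \<partial>lebesgue_on Y)"
    using integral_mono_AE[OF _ int ge] m by (simp add: mult.commute)
  then have "(\<integral>y. \<rho> y \<partial>lebesgue_on Y) > 0"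
    using \<open>\<rho>m > 0\<close> assms(2) mult_pos_pos[of \<rho>m] by (meson less_le_trans)
  then have "(\<integral>y. \<rho> y / cell_avg Y \<rho> \<partial>lebesgue_on Y) = measure lebesgue Y"
    using assms(2) by (simp add: cell_avg_def)
  then show ?thesis
    using int m by (simp add: rel_density_def)
qed

lemma cell_function_mean0: "cell_function Z Y C F w \<Longrightarrow> w \<in> H1_mean0 Z Y"
  and cell_function_H1: "cell_function Z Y C F w \<Longrightarrow> w \<in> H1 Y"
  and cell_function_eq: "cell_function Z Y C F w \<Longrightarrow> v \<in> H1_mean0 Z Y \<Longrightarrow> energy_form Y C w v = F v"
  by (auto simp: cell_function_def H1_mean0_imp_H1)

text \<open>
  Betti reciprocity: both sides are the symmetric energy \<open>A(w, v)\<close>, evaluated once by the equation of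
  \<open>w\<close> and once by that of \<open>v\<close>. The formulas for \<open>B1\<close> and \<open>B2\<close> come from this swap.
\<close>

lemma load_reciprocity:
  assumes "elasticity_tensor Y C" and w: "cell_function Z Y C F w" and v: "cell_function Z Y C G v"
  shows "F v = G w"
  using energy_form_commute[OF assms(1) cell_function_H1[OF w] cell_function_H1[OF v]]
    cell_function_eq[OF w cell_function_mean0[OF v]] cell_function_eq[OF v cell_function_mean0[OF w]]
  by simp

lemma integral_mean0:
  assumes "measure lebesgue Y > 0" "v \<in> H1_mean0 Z Y"
  shows "(\<integral>y. v y $ i \<partial>lebesgue_on Y) = 0"
  using assms by (simp add: H1_mean0_def cell_avg_def)

lemma integrable_mean0:
  assumes "Y \<in> lmeasurable" "Linf Y \<beta>" "v \<in> H1_mean0 Z Y"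
  shows "integrable (lebesgue_on Y) (\<lambda>y. v y $ i)" "integrable (lebesgue_on Y) (\<lambda>y. \<beta> y * v y $ i)"
  using assms by (auto intro!: integrable_L2 L2_Linf_mult L2_component H1_mean0_imp_H1)

lemma zeta2_load_eq:
  assumes "Y \<in> lmeasurable" "measure lebesgue Y > 0" "Linf Y \<beta>" "v \<in> H1_mean0 Z Y"
  shows "zeta2_load Y \<beta> n v = (\<integral>y. \<beta> y * v y $ n \<partial>lebesgue_on Y)"
  using integrable_mean0[OF assms(1,3,4)] integral_mean0[OF assms(2,4)]
  by (simp add: zeta2_load_def left_diff_distrib)

lemma L2_C_grad:
  assumes "elasticity_tensor Y C" "v \<in> H1 Y"
  shows "L2 Y (\<lambda>y. \<Sum>r\<in>UNIV. \<Sum>s\<in>UNIV. C y k l r s * wgrad Y v r s y)"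
  by (intro L2_sum L2_Linf_mult elasticity_tensor_Linf L2_wgrad assms)

section \<open>The inertial effective tensors\<close>

context
  fixes Y Z :: "(real ^ 'd::finite) set" and C :: "'d tensor4_field" and \<beta> :: "'d scalar_field"
    and \<chi>1 :: "'d \<Rightarrow> 'd \<Rightarrow> 'd vector_field" and \<zeta>2 :: "'d \<Rightarrow> 'd vector_field"
  assumes Y: "Y \<in> lmeasurable" "measure lebesgue Y > 0"
    and elast: "elasticity_tensor Y C" and \<beta>: "Linf Y \<beta>"
    and chi1: "\<And>k l. cell_function Z Y C (chi1_load Y C k l) (\<chi>1 k l)"
    and zeta2: "\<And>n. cell_function Z Y C (zeta2_load Y \<beta> n) (\<zeta>2 n)"
begin

lemmas chi1_mean0 = cell_function_mean0[OF chi1]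
lemmas zeta2_mean0 = cell_function_mean0[OF zeta2]
lemmas chi1_H1 = cell_function_H1[OF chi1]
lemmas zeta2_H1 = cell_function_H1[OF zeta2]

text \<open>
  The stress term \<open>\<integral>C\<^sub>i\<^sub>l\<^sub>p\<^sub>q\<zeta>\<^sub>p\<^sub>,\<^sub>q\<close> of \<open>B1\<close> is minus the load of \<open>\<chi>\<^bsup>1il\<^esup>\<close> on \<open>\<zeta>\<^bsup>2k\<^esup>\<close>; reciprocity turns it into the
  inertial load of \<open>\<zeta>\<^bsup>2k\<^esup>\<close> on \<open>\<chi>\<^bsup>1il\<^esup>\<close>.
\<close>

lemma B1_formula:
  "measure lebesgue Y * B1 Y C \<beta> \<chi>1 \<zeta>2 i k l =
     (\<integral>y. \<beta> y * \<chi>1 k l y $ i \<partial>lebesgue_on Y) - (\<integral>y. \<beta> y * \<chi>1 i l y $ k \<partial>lebesgue_on Y)"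
proof -
  have "measure lebesgue Y * B1 Y C \<beta> \<chi>1 \<zeta>2 i k l
      = - chi1_load Y C i l (\<zeta>2 k) + (\<integral>y. \<beta> y * \<chi>1 k l y $ i \<partial>lebesgue_on Y)"
    using Y(2) integrable_L2[OF Y(1) L2_C_grad[OF elast zeta2_H1]] integrable_mean0[OF Y(1) \<beta> chi1_mean0]
    by (simp add: B1_def cell_avg_def phi1_def chi1_load_def)
  also have "chi1_load Y C i l (\<zeta>2 k) = zeta2_load Y \<beta> k (\<chi>1 i l)"
    by (rule load_reciprocity[OF elast chi1 zeta2])
  finally show ?thesis by (simp add: zeta2_load_eq[OF Y \<beta> chi1_mean0])
qed

text \<open>
  Two reciprocities are combined. The pair \<open>\<chi>\<^bsup>1il\<^esup>, \<zeta>\<^bsup>3km\<^esup>\<close> removes \<open>\<zeta>3\<close> and leaves terms in which \<open>\<zeta>\<^bsup>2k\<^esup>\<close> is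
  coupled to \<open>\<chi>\<^bsup>1il\<^esup>\<close>; the pair \<open>\<zeta>\<^bsup>2k\<^esup>, \<chi>\<^bsup>2ilm\<^esup>\<close> says that these same terms add up to \<open>\<integral>\<beta>\<chi>\<^bsup>2ilm\<^esup>\<^sub>k\<close>. The effective
  constants subtracted in the loads drop out because the test fields have zero mean.
\<close>

lemma B2_formula:
  assumes chi2: "\<And>k l m. cell_function Z Y C (chi2_load Y C \<chi>1 k l m) (\<chi>2 k l m)"
    and zeta3: "\<And>k l. cell_function Z Y C (zeta3_load Y C \<beta> \<chi>1 \<zeta>2 k l) (\<zeta>3 k l)"
  shows "measure lebesgue Y * B2 Y C \<beta> \<chi>2 \<zeta>2 \<zeta>3 i l k m =
     (\<integral>y. \<beta> y * (\<chi>2 m k l y $ i + \<chi>2 i l m y $ k -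
                        (\<Sum>r\<in>UNIV. \<chi>1 i l y $ r * \<chi>1 k m y $ r)) \<partial>lebesgue_on Y)"
proof -
  let ?I = "\<lambda>f. integral\<^sup>L (lebesgue_on Y) f"
  let ?\<chi> = "\<chi>1 i l" and ?\<zeta> = "\<zeta>2 k"
  let ?\<sigma> = "\<lambda>w a r y. \<Sum>p\<in>UNIV. \<Sum>q\<in>UNIV. C y a r p q * wgrad Y w p q y"
  let ?c = "\<lambda>r. C0 Y C \<chi>1 i l m r" and ?B = "\<lambda>r. B1 Y C \<beta> \<chi>1 \<zeta>2 r k m"
  (* With \<zeta> = \<zeta>2 k and \<chi> = \<chi>1 i l: P couples the stress of \<zeta> to \<chi>, and Q the stress of \<chi> to \<zeta>; X is
     the stress term of B2 without a gradient. The primed versions are the same quantities as the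
     load of \<chi>2 produces them; P' differs from P by the order of the factors only, while Q' and X'
     agree with Q and X through the symmetries of C. *)
  define P where "P y = (\<Sum>r\<in>UNIV. ?\<sigma> ?\<zeta> r m y * ?\<chi> y $ r)" for y
  define P' where "P' y = (\<Sum>a\<in>UNIV. \<Sum>r\<in>UNIV. \<Sum>s\<in>UNIV. ?\<chi> y $ a * C y a m r s * wgrad Y ?\<zeta> r s y)" for y
  define Q where "Q y = (\<Sum>a\<in>UNIV. \<Sum>r\<in>UNIV. \<Sum>s\<in>UNIV. ?\<zeta> y $ a * C y a m r s * wgrad Y ?\<chi> r s y)" for y
  define Q' where "Q' y = (\<Sum>r\<in>UNIV. ?\<sigma> ?\<chi> m r y * ?\<zeta> y $ r)" for y
  define X where "X y = (\<Sum>a\<in>UNIV. C y i l a m * ?\<zeta> y $ a)" for y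
  define X' where "X' y = (\<Sum>r\<in>UNIV. C y m r i l * ?\<zeta> y $ r)" for y
  define N where "N y = (\<Sum>r\<in>UNIV. \<beta> y * \<chi>1 k m y $ r * ?\<chi> y $ r)" for y
  note L2s = elasticity_tensor_Linf[OF elast] L2_C_grad[OF elast] L2_component L2_wgrad \<beta>
    chi1_H1 zeta2_H1 cell_function_H1[OF chi2] cell_function_H1[OF zeta3]
  have int_P: "integrable (lebesgue_on Y) P"
    unfolding P_def by (intro Bochner_Integration.integrable_sum integrable_L2_mult L2s)
  have int_Q': "integrable (lebesgue_on Y) Q'"
    unfolding Q'_def by (intro Bochner_Integration.integrable_sum integrable_L2_mult L2s)
  have P': "P' = P"
    by (auto simp: P_def P'_def sum_distrib_left sum_distrib_right mult_ac)
  have Q_eq: "Q y = (\<Sum>r\<in>UNIV. ?\<sigma> ?\<chi> r m y * ?\<zeta> y $ r)" for y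
    by (auto simp: Q_def sum_distrib_left sum_distrib_right mult_ac)
  have int_Q: "integrable (lebesgue_on Y) Q"
    unfolding Q_eq by (intro Bochner_Integration.integrable_sum integrable_L2_mult L2s)
  have int_X: "integrable (lebesgue_on Y) X" and int_X': "integrable (lebesgue_on Y) X'"
    unfolding X_def X'_def
    by (intro Bochner_Integration.integrable_sum integrable_L2 L2_Linf_mult Y L2s)+
  have int_N: "integrable (lebesgue_on Y) N"
    unfolding N_def by (intro Bochner_Integration.integrable_sum integrable_L2_mult L2_Linf_mult L2s)
  have int_\<chi>2: "integrable (lebesgue_on Y) (\<lambda>y. \<beta> y * \<chi>2 a b c y $ n)" for a b c n
    by (rule integrable_mean0[OF Y(1) \<beta> cell_function_mean0[OF chi2]])
  have Q': "?I Q' = ?I Q"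
  proof (rule integral_cong_AE)
    show "AE y in lebesgue_on Y. Q' y = Q y"
      using elasticity_tensor_symmetric[OF elast]
      by eventually_elim (simp add: Q'_def Q_eq hooke_symmetric_def)
  qed (use int_Q int_Q' in auto)
  have X': "?I X' = ?I X"
  proof (rule integral_cong_AE)
    show "AE y in lebesgue_on Y. X' y = X y"
      using elasticity_tensor_symmetric[OF elast]
    proof eventually_elim
      case (elim y)
      then have "C y m r i l = C y i l r m" for r unfolding hooke_symmetric_def by metis
      then show ?case by (simp add: X'_def X_def)
    qed
  qed (use int_X int_X' in auto)
  have B2: "measure lebesgue Y * B2 Y C \<beta> \<chi>2 \<zeta>2 \<zeta>3 i l k m
      = - chi1_load Y C i l (\<zeta>3 k m) + ?I X + ?I (\<lambda>y. \<beta> y * \<chi>2 m k l y $ i)"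
    using Y(2) integrable_L2[OF Y(1) L2_C_grad[OF elast cell_function_H1[OF zeta3]]] int_X int_\<chi>2
    unfolding B2_def cell_avg_def phi2_def chi1_load_def X_def[symmetric] by simp
  have "chi1_load Y C i l (\<zeta>3 k m) = zeta3_load Y C \<beta> \<chi>1 \<zeta>2 k m ?\<chi>"
    by (rule load_reciprocity[OF elast chi1 zeta3])
  also have "\<dots> = ?I P + ?I N - ?I Q"
  proof -
    have "(\<Sum>r\<in>UNIV. (phi1 Y C \<beta> \<chi>1 \<zeta>2 r k m y - ?B r) * ?\<chi> y $ r)
        = P y + N y - (\<Sum>r\<in>UNIV. ?B r * ?\<chi> y $ r)" for y
      by (simp add: phi1_def P_def N_def algebra_simps sum.distrib sum_subtractf)
    moreover have "?I (\<lambda>y. P y + N y - (\<Sum>r\<in>UNIV. ?B r * ?\<chi> y $ r)) = ?I P + ?I N"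
      using int_P int_N integrable_mean0(1)[OF Y(1) \<beta> chi1_mean0] by (simp add: integral_mean0[OF Y(2) chi1_mean0])
    ultimately show ?thesis
      unfolding zeta3_load_def Q_def by simp
  qed
  finally have 1: "chi1_load Y C i l (\<zeta>3 k m) = ?I P + ?I N - ?I Q" .
  have "?I (\<lambda>y. \<beta> y * \<chi>2 i l m y $ k) = zeta2_load Y \<beta> k (\<chi>2 i l m)"
    by (simp add: zeta2_load_eq[OF Y \<beta> cell_function_mean0[OF chi2]])
  also have "\<dots> = chi2_load Y C \<chi>1 i l m ?\<zeta>"
    by (rule load_reciprocity[OF elast zeta2 chi2])
  also have "\<dots> = ?I Q' + ?I X' - ?I P'"
  proof -
    have "(\<Sum>r\<in>UNIV. (S0 Y C \<chi>1 i l y m r - ?c r) * ?\<zeta> y $ r)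
        = Q' y + X' y - (\<Sum>r\<in>UNIV. ?c r * ?\<zeta> y $ r)" for y
      by (simp add: S0_def Q'_def X'_def algebra_simps sum.distrib sum_subtractf)
    moreover have "?I (\<lambda>y. Q' y + X' y - (\<Sum>r\<in>UNIV. ?c r * ?\<zeta> y $ r) - P' y) = ?I Q' + ?I X' - ?I P'"
      unfolding P' using int_P int_Q' int_X' integrable_mean0(1)[OF Y(1) \<beta> zeta2_mean0]
      by (simp add: integral_mean0[OF Y(2) zeta2_mean0])
    ultimately show ?thesis
      unfolding chi2_load_def P'_def by simp
  qed
  finally have 2: "?I (\<lambda>y. \<beta> y * \<chi>2 i l m y $ k) = ?I Q + ?I X - ?I P"
    by (simp add: Q' X' P')
  have "?I (\<lambda>y. \<beta> y * (\<chi>2 m k l y $ i + \<chi>2 i l m y $ k - (\<Sum>r\<in>UNIV. ?\<chi> y $ r * \<chi>1 k m y $ r)))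
      = ?I (\<lambda>y. \<beta> y * \<chi>2 m k l y $ i + \<beta> y * \<chi>2 i l m y $ k - N y)"
    by (simp add: N_def algebra_simps sum_distrib_left)
  also have "\<dots> = ?I (\<lambda>y. \<beta> y * \<chi>2 m k l y $ i) + ?I (\<lambda>y. \<beta> y * \<chi>2 i l m y $ k) - ?I N"
    using int_\<chi>2 int_N by simp
  finally show ?thesis using B2 1 2 by simp
qed

lemma beta2_eq_energy:
  "measure lebesgue Y * beta2 Y \<beta> \<zeta>2 $ i $ k = energy_form Y C (\<zeta>2 i) (\<zeta>2 k)"
  using Y(2) cell_function_eq[OF zeta2 zeta2_mean0]
  by (simp add: beta2_def cell_avg_def zeta2_load_eq[OF Y \<beta> zeta2_mean0])

lemma transpose_beta2: "transpose (beta2 Y \<beta> \<zeta>2) = beta2 Y \<beta> \<zeta>2"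
proof -
  have "beta2 Y \<beta> \<zeta>2 $ i $ k = beta2 Y \<beta> \<zeta>2 $ k $ i" for i k
    using Y(2) beta2_eq_energy[of i k] beta2_eq_energy[of k i]
      energy_form_commute[OF elast zeta2_H1 zeta2_H1, of i k] by (metis less_irrefl mult_cancel_left)
  then show ?thesis by (simp add: vec_eq_iff transpose_def)
qed

text \<open>
  The quadratic form of \<open>\<beta>2\<close> at \<open>x\<close> is the energy of \<open>\<zeta> = \<Sum>x\<^sub>n\<zeta>\<^bsup>2n\<^esup>\<close> up to the factor \<open>|Y|\<close>. If it is not
  positive, \<open>\<zeta>\<close> does no work against \<open>v\<close>, and the equation of \<open>\<zeta>\<close> then says that its inertial load
  vanishes on \<open>v\<close>.
\<close>

lemma beta2_degenerate_imp_orthogonal: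
  assumes le: "x \<bullet> (beta2 Y \<beta> \<zeta>2 *v x) \<le> 0" and v: "v \<in> H1_mean0 Z Y"
  shows "(\<Sum>n\<in>UNIV. x $ n * (\<integral>y. \<beta> y * v y $ n \<partial>lebesgue_on Y)) = 0"
proof -
  have "(\<Sum>n\<in>UNIV. \<Sum>m\<in>UNIV. x $ n * x $ m * energy_form Y C (\<zeta>2 n) (\<zeta>2 m))
      = measure lebesgue Y * (x \<bullet> (beta2 Y \<beta> \<zeta>2 *v x))"
    by (simp add: beta2_eq_energy[symmetric] inner_vec_def matrix_vector_mult_def sum_distrib_left mult_ac)
  also have "\<dots> \<le> 0" using le Y(2) by (simp add: mult_le_0_iff)
  finally have "(\<Sum>n\<in>UNIV. x $ n * energy_form Y C (\<zeta>2 n) v) = 0"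
    by (rule energy_form_degenerate[OF elast zeta2_H1 _ H1_mean0_imp_H1[OF v]])
  then show ?thesis
    by (simp add: cell_function_eq[OF zeta2 v] zeta2_load_eq[OF Y \<beta> v])
qed

end

text \<open>
  Fields \<open>(\<Psi> - \<langle>\<Psi>\<rangle>)x\<close>, with \<open>\<Psi>\<close> the periodic extension of a test function, are admissible. Against them
  the hypothesis says that \<open>\<beta> - 1\<close> is orthogonal to every test function, since \<open>\<beta> - 1\<close> has zero mean,
  and the fundamental lemma applies.
\<close>

lemma density_constant_if_orthogonal:
  assumes Z: "lattice_basis b" "Z = lattice b" and cell: "periodicity_cell Z Y"
    and \<rho>: "mass_density Y \<rho>" and "x \<noteq> 0"
    and orth: "\<And>v. v \<in> H1_mean0 Z Y \<Longrightarrow>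
      (\<Sum>n\<in>UNIV. x $ n * (\<integral>y. rel_density Y \<rho> y * v y $ n \<partial>lebesgue_on Y)) = 0"
  shows "AE y in lebesgue_on Y. rel_density Y \<rho> y = 1"
proof -
  let ?\<beta> = "rel_density Y \<rho>"
  note Y = periodicity_cell_lmeasurable[OF cell]
  have Y': "open Y" "bounded Y" using cell by (auto simp: periodicity_cell_def)
  interpret finite_measure "lebesgue_on Y"
    using Y(1) by (rule finite_measure_lebesgue_on)
  note \<beta> = Linf_rel_density[OF \<rho>]
  have int_\<beta>: "integrable (lebesgue_on Y) ?\<beta>"
    by (intro integrable_L2 L2_Linf Y \<beta>)
  have total: "(\<integral>y. (?\<beta> y - 1) \<partial>lebesgue_on Y) = 0"
    by (rule integral_rel_density[OF Y \<rho>])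
  have "AE y in lebesgue_on Y. ?\<beta> y - 1 = 0"
  proof (rule AE_eq_0_if_orthogonal_to_test_functions[OF Y'(1)])
    show "integrable (lebesgue_on Y) (\<lambda>y. ?\<beta> y - 1)" using int_\<beta> by simp
    fix \<psi> assume \<psi>: "test_function Y \<psi>"
    obtain \<Psi> where \<Psi>: "smooth \<Psi>" and per: "\<And>V x. V \<in> Z \<Longrightarrow> \<Psi> (x + V) = \<Psi> x"
      and on_Y: "\<And>y. y \<in> Y \<Longrightarrow> \<Psi> y = \<psi> y"
      using test_function_periodic_extension[OF Z cell \<psi>] by blast
    define c where "c = cell_avg Y \<Psi>"
    define v where "v y = (\<Psi> y - c) *\<^sub>R x" for y
    have L2\<Psi>: "L2 Y \<Psi>" by (rule L2_smooth[OF Y(1) Y'(2) \<Psi>])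
    have int\<Psi>: "integrable (lebesgue_on Y) \<Psi>" by (rule integrable_L2[OF Y(1) L2\<Psi>])
    have int\<beta>\<Psi>: "integrable (lebesgue_on Y) (\<lambda>y. ?\<beta> y * \<Psi> y)"
      by (intro integrable_L2 Y L2_Linf_mult \<beta> L2\<Psi>)
    have "measure (lebesgue_on Y) (space (lebesgue_on Y)) = measure lebesgue Y"
      using Y(1) by (simp add: measure_restrict_space fmeasurableD)
    then have mean: "(\<integral>y. (\<Psi> y - c) \<partial>lebesgue_on Y) = 0"
      using int\<Psi> Y(2) by (simp add: c_def cell_avg_def)
    have "smooth (\<lambda>y. v y $ i)" for i
    proof -
      have "(\<lambda>y. v y $ i) = (\<lambda>y. (\<Psi> y + - c) * x $ i)" by (auto simp: v_def)
      then show ?thesis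
        unfolding smooth_def by (simp only:) (intro allI Ck_mult Ck_add Ck_const smooth_imp_Ck \<Psi>)
    qed
    then have "smooth_periodic Z v"
      using per by (simp add: smooth_periodic_def v_def)
    then have "v \<in> H1_per Z Y" by (rule smooth_periodic_imp_H1_per[OF Y(1) Y'])
    moreover have "cell_avg Y (\<lambda>y. v y $ i) = 0" for i
      using mean by (simp add: v_def cell_avg_def)
    ultimately have "v \<in> H1_mean0 Z Y" by (simp add: H1_mean0_def)
    have v_int: "(\<integral>y. ?\<beta> y * v y $ n \<partial>lebesgue_on Y) = (\<integral>y. ?\<beta> y * (\<Psi> y - c) \<partial>lebesgue_on Y) * x $ n" for n
      by (simp add: v_def mult.assoc[symmetric])
    from orth[OF \<open>v \<in> H1_mean0 Z Y\<close>]
    have "(x \<bullet> x) * (\<integral>y. ?\<beta> y * (\<Psi> y - c) \<partial>lebesgue_on Y) = 0"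
      unfolding v_int by (simp add: inner_vec_def sum_distrib_right mult_ac)
    then have 0: "(\<integral>y. ?\<beta> y * (\<Psi> y - c) \<partial>lebesgue_on Y) = 0"
      using \<open>x \<noteq> 0\<close> by simp
    have "(\<integral>y. (?\<beta> y - 1) * \<psi> y \<partial>lebesgue_on Y) = (\<integral>y. (?\<beta> y - 1) * \<Psi> y \<partial>lebesgue_on Y)"
      by (rule Bochner_Integration.integral_cong) (simp_all add: on_Y)
    also have "\<dots> = (\<integral>y. ?\<beta> y * (\<Psi> y - c) - (\<Psi> y - c) + c * (?\<beta> y - 1) \<partial>lebesgue_on Y)"
      by (simp add: algebra_simps)
    also have "\<dots> = (\<integral>y. ?\<beta> y * (\<Psi> y - c) \<partial>lebesgue_on Y) - (\<integral>y. \<Psi> y - c \<partial>lebesgue_on Y)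
        + c * (\<integral>y. ?\<beta> y - 1 \<partial>lebesgue_on Y)"
      using int\<beta>\<Psi> int_\<beta> int\<Psi> by (simp add: right_diff_distrib)
    finally show "(\<integral>y. (?\<beta> y - 1) * \<psi> y \<partial>lebesgue_on Y) = 0"
      using 0 mean total by simp
  qed
  then show ?thesis by eventually_elim simp
qed

theorem proposition2:
  fixes b :: "'d::finite \<Rightarrow> real ^ 'd"
    and Z Y :: "(real ^ 'd) set"
    and C :: "'d tensor4_field"
    and \<rho> \<beta> :: "'d scalar_field"
    and \<chi>1 \<zeta>3 :: "'d \<Rightarrow> 'd \<Rightarrow> 'd vector_field"
    and \<chi>2 :: "'d \<Rightarrow> 'd \<Rightarrow> 'd \<Rightarrow> 'd vector_field"
    and \<zeta>2 :: "'d \<Rightarrow> 'd vector_field"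
  defines "Z \<equiv> lattice b"
    and "\<beta> \<equiv> rel_density Y \<rho>"
  assumes dim: "CARD('d) = 2 \<or> CARD('d) = 3"
    and basis: "lattice_basis b"
    and cell: "periodicity_cell Z Y"
    and elast: "elasticity_tensor Y C"
    and dens: "mass_density Y \<rho>"
    and chi1: "\<And>k l. cell_function Z Y C (chi1_load Y C k l) (\<chi>1 k l)"
    and chi2: "\<And>k l m. cell_function Z Y C (chi2_load Y C \<chi>1 k l m) (\<chi>2 k l m)"
    and zeta2: "\<And>n. cell_function Z Y C (zeta2_load Y \<beta> n) (\<zeta>2 n)"
    and zeta3: "\<And>k l. cell_function Z Y C (zeta3_load Y C \<beta> \<chi>1 \<zeta>2 k l) (\<zeta>3 k l)"
  shows "(\<forall>i k l.
            B1 Y C \<beta> \<chi>1 \<zeta>2 i k l =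
              1 / measure lebesgue Y *
                (\<integral>y. \<beta> y * (\<chi>1 k l y $ i - \<chi>1 i l y $ k) \<partial>lebesgue_on Y) \<and>
            B1 Y C \<beta> \<chi>1 \<zeta>2 i k l =
              cell_avg Y (\<lambda>y. \<beta> y * \<chi>1 k l y $ i) - cell_avg Y (\<lambda>y. \<beta> y * \<chi>1 i l y $ k)) \<and>
         (\<forall>i l k m.
            B2 Y C \<beta> \<chi>2 \<zeta>2 \<zeta>3 i l k m =
              1 / measure lebesgue Y *
                (\<integral>y. \<beta> y * (\<chi>2 m k l y $ i + \<chi>2 i l m y $ k -
                        (\<Sum>r\<in>UNIV. \<chi>1 i l y $ r * \<chi>1 k m y $ r)) \<partial>lebesgue_on Y)) \<and>
         (\<forall>i k. measure lebesgue Y * beta2 Y \<beta> \<zeta>2 $ i $ k = energy_form Y C (\<zeta>2 i) (\<zeta>2 k)) \<and>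
         (\<not> (AE y in lebesgue_on Y. \<beta> y = 1) \<longrightarrow> positive_definite (beta2 Y \<beta> \<zeta>2)) \<and>
         ((AE y in lebesgue_on Y. \<beta> y = 1) \<longrightarrow> beta2 Y \<beta> \<zeta>2 = 0)"
proof (intro conjI allI impI)
  note Y = periodicity_cell_lmeasurable[OF cell]
  have \<beta>: "Linf Y \<beta>" unfolding \<beta>_def by (rule Linf_rel_density[OF dens])
  note setting = Y elast \<beta> chi1 zeta2
  have int_\<chi>1: "integrable (lebesgue_on Y) (\<lambda>y. \<beta> y * \<chi>1 k l y $ i)" for k l i
    by (rule integrable_mean0(2)[OF Y(1) \<beta> cell_function_mean0[OF chi1]])
  {
    fix i k l
    show "B1 Y C \<beta> \<chi>1 \<zeta>2 i k l =
        cell_avg Y (\<lambda>y. \<beta> y * \<chi>1 k l y $ i) - cell_avg Y (\<lambda>y. \<beta> y * \<chi>1 i l y $ k)"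
      using B1_formula[OF setting, of i k l] Y(2)
      by (simp add: cell_avg_def field_simps)
    then show "B1 Y C \<beta> \<chi>1 \<zeta>2 i k l = 1 / measure lebesgue Y *
        (\<integral>y. \<beta> y * (\<chi>1 k l y $ i - \<chi>1 i l y $ k) \<partial>lebesgue_on Y)"
      using int_\<chi>1 by (simp add: cell_avg_def right_diff_distrib diff_divide_distrib)
  next
    fix i l k m
    show "B2 Y C \<beta> \<chi>2 \<zeta>2 \<zeta>3 i l k m = 1 / measure lebesgue Y *
        (\<integral>y. \<beta> y * (\<chi>2 m k l y $ i + \<chi>2 i l m y $ k -
                (\<Sum>r\<in>UNIV. \<chi>1 i l y $ r * \<chi>1 k m y $ r)) \<partial>lebesgue_on Y)"
      using B2_formula[OF setting chi2 zeta3, of i l k m] Y(2) by (simp add: field_simps)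
  next
    fix i k
    show "measure lebesgue Y * beta2 Y \<beta> \<zeta>2 $ i $ k = energy_form Y C (\<zeta>2 i) (\<zeta>2 k)"
      by (rule beta2_eq_energy[OF setting])
  next
    assume nonconst: "\<not> (AE y in lebesgue_on Y. \<beta> y = 1)"
    show "positive_definite (beta2 Y \<beta> \<zeta>2)"
      unfolding positive_definite_def
    proof (intro conjI allI impI transpose_beta2[OF setting])
      fix x :: "real ^ 'd" assume "x \<noteq> 0"
      show "x \<bullet> (beta2 Y \<beta> \<zeta>2 *v x) > 0"
      proof (rule ccontr)
        assume "\<not> x \<bullet> (beta2 Y \<beta> \<zeta>2 *v x) > 0"
        then have le: "x \<bullet> (beta2 Y \<beta> \<zeta>2 *v x) \<le> 0" by simp
        have "AE y in lebesgue_on Y. \<beta> y = 1"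
          unfolding \<beta>_def
          by (rule density_constant_if_orthogonal[OF basis Z_def[THEN meta_eq_to_obj_eq] cell dens \<open>x \<noteq> 0\<close>])
            (rule beta2_degenerate_imp_orthogonal[OF setting le, unfolded \<beta>_def])
        with nonconst show False by contradiction
      qed
    qed
  next
    assume one: "AE y in lebesgue_on Y. \<beta> y = 1"
    have "(\<integral>y. \<beta> y * \<zeta>2 k y $ i \<partial>lebesgue_on Y) = 0" for i k
    proof -
      have mean0: "\<zeta>2 k \<in> H1_mean0 Z Y" using zeta2 by (simp add: cell_function_def)
      have "AE y in lebesgue_on Y. \<beta> y * \<zeta>2 k y $ i = \<zeta>2 k y $ i"
        using one by eventually_elim simp
      then have "(\<integral>y. \<beta> y * \<zeta>2 k y $ i \<partial>lebesgue_on Y) = (\<integral>y. \<zeta>2 k y $ i \<partial>lebesgue_on Y)"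
        using integrable_mean0[OF Y(1) \<beta> mean0] by (intro integral_cong_AE) auto
      then show ?thesis using integral_mean0[OF Y(2) mean0] by simp
    qed
    then show "beta2 Y \<beta> \<zeta>2 = 0" by (simp add: beta2_def cell_avg_def vec_eq_iff)
  }
qed

end
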